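(* The class of all $0$-reduced epigroup varieties is definable in the lattice $\mathbf{EPI}$.
   Context: An epigroup is a semigroup $S$ such that for every $x\in S$ some power $x^n$ ($n\ge 1$) lies in a subgroup of $S$. For $x\in S$ some power of $x$ lies in a maximal subgroup $G_x$ of $S$; its unit is denoted $x^\omega$. Then $xx^\omega=x^\omega x\in G_x$, and the pseudoinverse $\overline{x}$ of $x$ is the inverse of $xx^\omega$ in $G_x$. Epigroups are considered as algebras with multiplication and the unary operation $x\mapsto\overline{x}$; an epigroup variety is a variety of such algebras consisting of epigroups. $\mathbf{EPI}$ is the lattice of all epigroup varieties under inclusion: $\wedge$ is intersection, and $\mathcal X\vee\mathcal Y$ is the least epigroup variety containing $\mathcal X$ and $\mathcal Y$. The symbol $w=0$ abbreviates the pair of identities $wx=xw=w$ where $x$ is a letter not occurring in the word $w$; such identities, and epigroup varieties given by them, are called $0$-reduced. A subset $A$ of a lattice $\langle L;\vee,\wedge\rangle$ is definable in $L$ if there is a first-order formula $\Phi(x)$ with one free variable $x$ in the language of the lattice operations $\vee$ and $\wedge$ such that, for every $a\in L$, the sentence $\Phi(a)$ is true in $L$ if and only if $a\in A$. *)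

theory Defs
  imports "HOL-Algebra.Group"
begin

section \<open>Algebras with one binary and one unary operation\<close>

record 'a unary_alg = "'a partial_object" +
  prd :: "'a \<Rightarrow> 'a \<Rightarrow> 'a"
  bar :: "'a \<Rightarrow> 'a"

definition is_unary_alg :: "'a unary_alg \<Rightarrow> bool" where
  "is_unary_alg S \<longleftrightarrow> carrier S \<noteq> {} \<and>
     (\<forall>x\<in>carrier S. \<forall>y\<in>carrier S. prd S x y \<in> carrier S) \<and>
     (\<forall>x\<in>carrier S. bar S x \<in> carrier S)"

definition is_semigroup :: "'a unary_alg \<Rightarrow> bool" where
  "is_semigroup S \<longleftrightarrow> carrier S \<noteq> {} \<and>
     (\<forall>x\<in>carrier S. \<forall>y\<in>carrier S. prd S x y \<in> carrier S) \<and>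
     (\<forall>x\<in>carrier S. \<forall>y\<in>carrier S. \<forall>z\<in>carrier S.
        prd S (prd S x y) z = prd S x (prd S y z))"


section \<open>Epigroups\<close>

text \<open>A semigroup has no zeroth power, so the exponent is shifted:
  \<^term>\<open>pow_Suc S x n\<close> is the power of \<open>x\<close> with exponent \<open>n + 1\<close>.\<close>

primrec pow_Suc :: "'a unary_alg \<Rightarrow> 'a \<Rightarrow> nat \<Rightarrow> 'a" where
  "pow_Suc S x 0 = x"
| "pow_Suc S x (Suc n) = prd S (pow_Suc S x n) x"

abbreviation grp :: "'a unary_alg \<Rightarrow> 'a set \<Rightarrow> 'a \<Rightarrow> 'a monoid" where
  "grp S G e \<equiv> \<lparr>carrier = G, mult = prd S, one = e\<rparr>"

definition subgroup_of :: "'a unary_alg \<Rightarrow> 'a set \<Rightarrow> 'a \<Rightarrow> bool" where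
  "subgroup_of S G e \<longleftrightarrow> G \<subseteq> carrier S \<and> group (grp S G e)"

definition maximal_subgroup_of :: "'a unary_alg \<Rightarrow> 'a set \<Rightarrow> 'a \<Rightarrow> bool" where
  "maximal_subgroup_of S G e \<longleftrightarrow> subgroup_of S G e \<and>
     (\<forall>H f. subgroup_of S H f \<and> G \<subseteq> H \<longrightarrow> H = G)"

text \<open>The maximal subgroup \<open>G\<close> containing some power of \<open>x\<close> is unique, hence so are its unit
  \<open>e\<close> (the idempotent written \<open>x\<close> to the power omega) and the pseudoinverse \<open>y\<close>.\<close>

definition is_pseudoinverse :: "'a unary_alg \<Rightarrow> 'a \<Rightarrow> 'a \<Rightarrow> bool" where
  "is_pseudoinverse S x y \<longleftrightarrow>
     (\<exists>G e. maximal_subgroup_of S G e \<and> (\<exists>n. pow_Suc S x n \<in> G) \<and>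
        prd S x e \<in> G \<and> y = inv\<^bsub>grp S G e\<^esub> (prd S x e))"

definition epigroup :: "'a unary_alg \<Rightarrow> bool" where
  "epigroup S \<longleftrightarrow> is_semigroup S \<and>
     (\<forall>x\<in>carrier S. \<exists>n G e. subgroup_of S G e \<and> pow_Suc S x n \<in> G) \<and>
     (\<forall>x\<in>carrier S. is_pseudoinverse S x (bar S x))"


section \<open>Identities and varieties\<close>

text \<open>Words are represented by terms. Different bracketings of the same word are not
  identified, but they have the same values in every semigroup.\<close>

datatype uword = Letter nat | Prod uword uword | Bar uword

primrec letters :: "uword \<Rightarrow> nat set" where
  "letters (Letter i) = {i}"
| "letters (Prod u v) = letters u \<union> letters v"
| "letters (Bar u) = letters u"

primrec word_val :: "'a unary_alg \<Rightarrow> (nat \<Rightarrow> 'a) \<Rightarrow> uword \<Rightarrow> 'a" where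
  "word_val S h (Letter i) = h i"
| "word_val S h (Prod u v) = prd S (word_val S h u) (word_val S h v)"
| "word_val S h (Bar u) = bar S (word_val S h u)"

type_synonym identity = "uword \<times> uword"

definition satisfies :: "'a unary_alg \<Rightarrow> identity set \<Rightarrow> bool" where
  "satisfies S \<Sigma> \<longleftrightarrow>
     (\<forall>(u, v)\<in>\<Sigma>. \<forall>h. range h \<subseteq> carrier S \<longrightarrow> word_val S h u = word_val S h v)"

text \<open>A class of algebras is represented by the set of its members whose carrier lies in the
  type \<open>'a\<close>. A variety is determined by its countable members, and an algebra fails to be an
  epigroup iff one of its countable subalgebras does. So for every infinite type \<open>'a\<close> this
  representation loses nothing.\<close>

definition variety :: "'a unary_alg set \<Rightarrow> bool" where
  "variety V \<longleftrightarrow> (\<exists>\<Sigma>. V = {S. is_unary_alg S \<and> satisfies S \<Sigma>})"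

definition epigroup_variety :: "'a unary_alg set \<Rightarrow> bool" where
  "epigroup_variety V \<longleftrightarrow> variety V \<and> (\<forall>S\<in>V. epigroup S)"

definition EPI :: "'a unary_alg set set" where
  "EPI = {V. epigroup_variety V}"

definition epi_meet :: "'a unary_alg set \<Rightarrow> 'a unary_alg set \<Rightarrow> 'a unary_alg set" where
  "epi_meet X Y = X \<inter> Y"

definition epi_join :: "'a unary_alg set \<Rightarrow> 'a unary_alg set \<Rightarrow> 'a unary_alg set" where
  "epi_join X Y = (LEAST Z. epigroup_variety Z \<and> X \<subseteq> Z \<and> Y \<subseteq> Z)"

definition eq_zero :: "uword \<Rightarrow> identity set" where
  "eq_zero w =
     (\<Union>x\<in>- letters w. {(Prod w (Letter x), w), (Prod (Letter x) w, w)})"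

text \<open>The identities are imposed within the class of epigroups. That class is not itself a
  variety, so \<^term>\<open>epigroup_variety V\<close> is a genuine restriction on the set \<open>W\<close>.\<close>

definition zero_reduced_variety :: "'a unary_alg set \<Rightarrow> bool" where
  "zero_reduced_variety V \<longleftrightarrow> epigroup_variety V \<and>
     (\<exists>W. V = {S. epigroup S \<and> (\<forall>w\<in>W. satisfies S (eq_zero w))})"


section \<open>First-order definability in lattices\<close>

datatype lterm = LVar nat | LJoin lterm lterm | LMeet lterm lterm

datatype lform =
    LEq lterm lterm
  | LNot lform
  | LAnd lform lform
  | LOr lform lform
  | LImp lform lform
  | LAll nat lform
  | LEx nat lform

primrec lterm_vars :: "lterm \<Rightarrow> nat set" where
  "lterm_vars (LVar i) = {i}"
| "lterm_vars (LJoin s t) = lterm_vars s \<union> lterm_vars t"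
| "lterm_vars (LMeet s t) = lterm_vars s \<union> lterm_vars t"

primrec free_vars :: "lform \<Rightarrow> nat set" where
  "free_vars (LEq s t) = lterm_vars s \<union> lterm_vars t"
| "free_vars (LNot p) = free_vars p"
| "free_vars (LAnd p q) = free_vars p \<union> free_vars q"
| "free_vars (LOr p q) = free_vars p \<union> free_vars q"
| "free_vars (LImp p q) = free_vars p \<union> free_vars q"
| "free_vars (LAll i p) = free_vars p - {i}"
| "free_vars (LEx i p) = free_vars p - {i}"

primrec lterm_val ::
    "('l \<Rightarrow> 'l \<Rightarrow> 'l) \<Rightarrow> ('l \<Rightarrow> 'l \<Rightarrow> 'l) \<Rightarrow> (nat \<Rightarrow> 'l) \<Rightarrow> lterm \<Rightarrow> 'l" where
  "lterm_val jn mt \<sigma> (LVar i) = \<sigma> i"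
| "lterm_val jn mt \<sigma> (LJoin s t) = jn (lterm_val jn mt \<sigma> s) (lterm_val jn mt \<sigma> t)"
| "lterm_val jn mt \<sigma> (LMeet s t) = mt (lterm_val jn mt \<sigma> s) (lterm_val jn mt \<sigma> t)"

primrec holds ::
    "'l set \<Rightarrow> ('l \<Rightarrow> 'l \<Rightarrow> 'l) \<Rightarrow> ('l \<Rightarrow> 'l \<Rightarrow> 'l) \<Rightarrow> (nat \<Rightarrow> 'l) \<Rightarrow> lform \<Rightarrow> bool" where
  "holds L jn mt \<sigma> (LEq s t) \<longleftrightarrow> lterm_val jn mt \<sigma> s = lterm_val jn mt \<sigma> t"
| "holds L jn mt \<sigma> (LNot p) \<longleftrightarrow> \<not> holds L jn mt \<sigma> p"
| "holds L jn mt \<sigma> (LAnd p q) \<longleftrightarrow> holds L jn mt \<sigma> p \<and> holds L jn mt \<sigma> q"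
| "holds L jn mt \<sigma> (LOr p q) \<longleftrightarrow> holds L jn mt \<sigma> p \<or> holds L jn mt \<sigma> q"
| "holds L jn mt \<sigma> (LImp p q) \<longleftrightarrow> (holds L jn mt \<sigma> p \<longrightarrow> holds L jn mt \<sigma> q)"
| "holds L jn mt \<sigma> (LAll i p) \<longleftrightarrow> (\<forall>b\<in>L. holds L jn mt (\<sigma>(i := b)) p)"
| "holds L jn mt \<sigma> (LEx i p) \<longleftrightarrow> (\<exists>b\<in>L. holds L jn mt (\<sigma>(i := b)) p)"

text \<open>Since \<open>x\<close> is the only free variable of \<open>\<Phi>\<close>, the values of the constant assignment at
  the other variables are irrelevant.\<close>

definition definable_in ::
    "'l set \<Rightarrow> ('l \<Rightarrow> 'l \<Rightarrow> 'l) \<Rightarrow> ('l \<Rightarrow> 'l \<Rightarrow> 'l) \<Rightarrow> 'l set \<Rightarrow> bool" where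
  "definable_in L jn mt A \<longleftrightarrow> A \<subseteq> L \<and>
     (\<exists>\<Phi> x. free_vars \<Phi> = {x} \<and> (\<forall>a\<in>L. holds L jn mt (\<lambda>_. a) \<Phi> \<longleftrightarrow> a \<in> A))"

end

theory Submission
  imports Defs "HOL-Library.Countable"
begin

text \<open>
  Call \<open>V\<close> lower-modular if \<open>V \<or> (Y \<and> Z) = Y \<and> (V \<or> Z)\<close> for all \<open>Y \<ge> V\<close> and all \<open>Z\<close>, and modular
  if \<open>(V \<or> Y) \<and> Z = (V \<and> Z) \<or> Y\<close> for all \<open>Y \<le> Z\<close>. A variety \<open>V\<close> is 0-reduced if and only if it
  is lower-modular and lies below a modular variety \<open>W\<close> that has a least nontrivial subvariety
  \<open>A \<noteq> W\<close>. These conditions are first-order.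

  The lattice is dual to the lattice of equational theories, that is, of the fully invariant
  congruences on terms that contain the identities of epigroups and \<open>x^n x (bar x) = x^n\<close> for some
  \<open>n\<close>. The theory of a 0-reduced variety collapses an ideal of words, the zeros, and adds nothing to
  associativity outside it. Any other theory can therefore take over all its steps outside the
  zeros, and lower-modularity and modularity follow by inspection of chains
  (\<open>zero_reduced_imp_lower_modular\<close>, \<open>zero_reduced_imp_modular\<close>). A 0-reduced variety is nil, and
  for \<open>W\<close> one can take its join with the semigroups in which \<open>xyz = 0\<close>, where \<open>A\<close> is the variety of
  null semigroups.

  Conversely, modularity of \<open>W\<close> forces an identity \<open>x^(k+1) y^(k+1) = y^(2k+1) x^2\<close>
  (\<open>modular_imp_identity\<close>), as is seen by testing it with a nilpotent variety and its
  subvariety in which the two sides of the identity form a class of their own. So \<open>W\<close> is aperiodic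
  and its idempotents commute. In the presence of \<open>A\<close> this makes \<open>W\<close>, and hence \<open>V\<close>, nil
  (\<open>modular_monolithic_imp_nil\<close>). Finally let \<open>V\<close> be nil and lower-modular. Lower-modularity is
  tested with the 0-reduced variety that has the same zeros as \<open>V\<close> and with a variety of groups.
  In groups \<open>p = p (bar x) x\<close>, and the right hand side is zero in \<open>V\<close>. It follows that an
  identity \<open>p = q\<close> of \<open>V\<close> with \<open>p \<noteq> 0\<close> holds in these groups, and then it is trivial because the
  affine group of a line separates words of letters (\<open>nil_lower_modular_imp_zero_reduced\<close>).\<close>

section \<open>Fully invariant congruences and their models\<close>

primrec substitute :: "(nat \<Rightarrow> uword) \<Rightarrow> uword \<Rightarrow> uword" where
  "substitute \<sigma> (Letter i) = \<sigma> i"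
| "substitute \<sigma> (Prod u v) = Prod (substitute \<sigma> u) (substitute \<sigma> v)"
| "substitute \<sigma> (Bar u) = Bar (substitute \<sigma> u)"

definition theory_of :: "'a unary_alg \<Rightarrow> identity set" where
  "theory_of S =
     {(u, v). \<forall>h. range h \<subseteq> carrier S \<longrightarrow> word_val S h u = word_val S h v}"

definition models :: "identity set \<Rightarrow> 'a unary_alg set" where
  "models \<theta> = {S. is_unary_alg S \<and> satisfies S \<theta>}"

definition fully_invariant :: "identity set \<Rightarrow> bool" where
  "fully_invariant \<theta> \<longleftrightarrow> equiv UNIV \<theta> \<and>
     (\<forall>u u' v v'. (u, u') \<in> \<theta> \<longrightarrow> (v, v') \<in> \<theta> \<longrightarrow> (Prod u v, Prod u' v') \<in> \<theta>) \<and>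
     (\<forall>u u'. (u, u') \<in> \<theta> \<longrightarrow> (Bar u, Bar u') \<in> \<theta>) \<and>
     (\<forall>u u' \<sigma>. (u, u') \<in> \<theta> \<longrightarrow> (substitute \<sigma> u, substitute \<sigma> u') \<in> \<theta>)"

lemma fully_invariantI:
  assumes "\<And>u. (u, u) \<in> \<theta>" "\<And>u v. (u, v) \<in> \<theta> \<Longrightarrow> (v, u) \<in> \<theta>"
    "\<And>u v w. (u, v) \<in> \<theta> \<Longrightarrow> (v, w) \<in> \<theta> \<Longrightarrow> (u, w) \<in> \<theta>"
    "\<And>u v w. (u, v) \<in> \<theta> \<Longrightarrow> (Prod u w, Prod v w) \<in> \<theta>"
    "\<And>u v w. (u, v) \<in> \<theta> \<Longrightarrow> (Prod w u, Prod w v) \<in> \<theta>"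
    "\<And>u v. (u, v) \<in> \<theta> \<Longrightarrow> (Bar u, Bar v) \<in> \<theta>"
    "\<And>u v \<sigma>. (u, v) \<in> \<theta> \<Longrightarrow> (substitute \<sigma> u, substitute \<sigma> v) \<in> \<theta>"
  shows "fully_invariant \<theta>"
  unfolding fully_invariant_def
proof (intro conjI allI impI)
  show "equiv UNIV \<theta>"
  proof (rule equivI)
    show "refl_on UNIV \<theta>" using assms(1) by (simp add: refl_on_def)
    show "sym \<theta>" using assms(2) by (rule symI)
    show "trans \<theta>" using assms(3) by (rule transI)
  qed auto
  fix u u' v v' assume "(u, u') \<in> \<theta>" "(v, v') \<in> \<theta>"
  then show "(Prod u v, Prod u' v') \<in> \<theta>" using assms(3-5) by blast
qed (simp_all add: assms(6,7))

context
  fixes \<theta> assumes fi: "fully_invariant \<theta>"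
begin

lemma fi_refl: "(u, u) \<in> \<theta>"
  using fi by (auto simp: fully_invariant_def equiv_def refl_on_def)

lemma fi_sym: "(u, v) \<in> \<theta> \<Longrightarrow> (v, u) \<in> \<theta>"
  using fi by (auto simp: fully_invariant_def equiv_def sym_def)

lemma fi_trans: "(u, v) \<in> \<theta> \<Longrightarrow> (v, w) \<in> \<theta> \<Longrightarrow> (u, w) \<in> \<theta>"
  using fi by (auto simp: fully_invariant_def equiv_def trans_def)

lemma fi_Prod: "(u, u') \<in> \<theta> \<Longrightarrow> (v, v') \<in> \<theta> \<Longrightarrow> (Prod u v, Prod u' v') \<in> \<theta>"
  using fi by (auto simp: fully_invariant_def)

lemma fi_Bar: "(u, u') \<in> \<theta> \<Longrightarrow> (Bar u, Bar u') \<in> \<theta>"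
  using fi by (auto simp: fully_invariant_def)

lemma fi_substitute: "(u, u') \<in> \<theta> \<Longrightarrow> (substitute \<sigma> u, substitute \<sigma> u') \<in> \<theta>"
  using fi by (auto simp: fully_invariant_def)

end

lemma substitute_cong: "(\<And>i. i \<in> letters u \<Longrightarrow> \<sigma> i = \<tau> i) \<Longrightarrow> substitute \<sigma> u = substitute \<tau> u"
  by (induction u) auto

lemma substitute_Letter [simp]: "substitute Letter u = u"
  by (induction u) auto

lemma finite_letters [simp]: "finite (letters u)"
  by (induction u) auto

lemma letters_substitute: "letters (substitute \<sigma> u) = (\<Union>i\<in>letters u. letters (\<sigma> i))"
  by (induction u) auto

lemma word_val_substitute:
  "word_val S h (substitute \<sigma> u) = word_val S (\<lambda>i. word_val S h (\<sigma> i)) u"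
  by (induction u) auto

lemma word_val_in_carrier:
  "is_unary_alg S \<Longrightarrow> range h \<subseteq> carrier S \<Longrightarrow> word_val S h u \<in> carrier S"
  by (induction u) (auto simp: is_unary_alg_def)

lemma satisfies_iff: "satisfies S \<Sigma> \<longleftrightarrow> \<Sigma> \<subseteq> theory_of S"
  by (auto simp: satisfies_def theory_of_def)

lemma models_iff: "S \<in> models \<theta> \<longleftrightarrow> is_unary_alg S \<and> \<theta> \<subseteq> theory_of S"
  by (auto simp: models_def satisfies_iff)

lemma theory_ofD:
  "(u, v) \<in> theory_of S \<Longrightarrow> range h \<subseteq> carrier S \<Longrightarrow> word_val S h u = word_val S h v"
  by (auto simp: theory_of_def)

lemma modelsD:
  "S \<in> models \<theta> \<Longrightarrow> (u, v) \<in> \<theta> \<Longrightarrow> range h \<subseteq> carrier S \<Longrightarrow> word_val S h u = word_val S h v"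
  by (auto simp: models_iff intro: theory_ofD)

lemma fully_invariant_theory_of:
  fixes S :: "'a unary_alg"
  assumes "is_unary_alg S"
  shows "fully_invariant (theory_of S)"
proof (rule fully_invariantI)
  fix u v \<sigma> assume uv: "(u, v) \<in> theory_of S"
  show "(substitute \<sigma> u, substitute \<sigma> v) \<in> theory_of S"
    unfolding theory_of_def
  proof clarify
    fix h :: "nat \<Rightarrow> 'a" assume "range h \<subseteq> carrier S"
    then have "range (\<lambda>i. word_val S h (\<sigma> i)) \<subseteq> carrier S"
      using word_val_in_carrier[OF assms] by auto
    then show "word_val S h (substitute \<sigma> u) = word_val S h (substitute \<sigma> v)"
      unfolding word_val_substitute using uv by (auto dest: theory_ofD)
  qed
qed (auto simp: theory_of_def)

lemma fully_invariant_Inter: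
  assumes "fully_invariant \<theta>" "fully_invariant \<eta>"
  shows "fully_invariant (\<theta> \<inter> \<eta>)"
proof (rule fully_invariantI)
  fix u v w assume "(u, v) \<in> \<theta> \<inter> \<eta>" "(v, w) \<in> \<theta> \<inter> \<eta>"
  then show "(u, w) \<in> \<theta> \<inter> \<eta>" using assms by (meson IntD1 IntD2 IntI fi_trans)
next
  fix u v assume "(u, v) \<in> \<theta> \<inter> \<eta>"
  then show "(v, u) \<in> \<theta> \<inter> \<eta>" using assms by (meson IntD1 IntD2 IntI fi_sym)
qed (use assms in \<open>simp_all add: fi_refl fi_Prod fi_Bar fi_substitute\<close>)

text \<open>Transitivity makes the reflexive transitive closure of the union the join of two fully
  invariant congruences: no closure under the operations has to be added, because these can be
  applied to one step of a chain at a time.\<close>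

lemma fully_invariant_rtrancl:
  assumes "fully_invariant \<theta>" "fully_invariant \<eta>"
  shows "fully_invariant ((\<theta> \<union> \<eta>)\<^sup>*)"
proof (rule fully_invariantI)
  have sy: "sym (\<theta> \<union> \<eta>)"
    using assms by (meson Un_iff fi_sym symI)
  show "(v, u) \<in> (\<theta> \<union> \<eta>)\<^sup>*" if "(u, v) \<in> (\<theta> \<union> \<eta>)\<^sup>*" for u v
    using that sym_rtrancl[OF sy] by (meson symD)
  have lift: "(f u, f v) \<in> (\<theta> \<union> \<eta>)\<^sup>*"
    if "(u, v) \<in> (\<theta> \<union> \<eta>)\<^sup>*" "\<And>u v. (u, v) \<in> \<theta> \<union> \<eta> \<Longrightarrow> (f u, f v) \<in> \<theta> \<union> \<eta>" for f u v
    using that(1) by induction (use that(2) in \<open>blast intro: rtrancl_into_rtrancl\<close>)+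
  fix u v w \<sigma> assume uv: "(u, v) \<in> (\<theta> \<union> \<eta>)\<^sup>*"
  note fi = fi_refl fi_Prod fi_Bar fi_substitute
  show "(Prod u w, Prod v w) \<in> (\<theta> \<union> \<eta>)\<^sup>*"
    by (rule lift[OF uv]) (use assms in \<open>auto simp: fi\<close>)
  show "(Prod w u, Prod w v) \<in> (\<theta> \<union> \<eta>)\<^sup>*"
    by (rule lift[OF uv]) (use assms in \<open>auto simp: fi\<close>)
  show "(Bar u, Bar v) \<in> (\<theta> \<union> \<eta>)\<^sup>*"
    by (rule lift[OF uv]) (use assms in \<open>auto simp: fi\<close>)
  show "(substitute \<sigma> u, substitute \<sigma> v) \<in> (\<theta> \<union> \<eta>)\<^sup>*"
    by (rule lift[OF uv]) (use assms in \<open>auto simp: fi\<close>)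
qed auto

lemma models_rtrancl: "models ((\<theta> \<union> \<eta>)\<^sup>*) = models \<theta> \<inter> models \<eta>"
proof -
  have "(\<theta> \<union> \<eta>)\<^sup>* \<subseteq> theory_of S" if "is_unary_alg S" "\<theta> \<union> \<eta> \<subseteq> theory_of S" for S :: "'a unary_alg"
  proof clarify
    fix u v assume "(u, v) \<in> (\<theta> \<union> \<eta>)\<^sup>*"
    then show "(u, v) \<in> theory_of S"
    proof induction
      case base
      show ?case by (simp add: theory_of_def)
    next
      case (step v w)
      then show ?case
        using fi_trans[OF fully_invariant_theory_of[OF that(1)]] that(2) by blast
    qed
  qed
  moreover have "\<theta> \<union> \<eta> \<subseteq> (\<theta> \<union> \<eta>)\<^sup>*" by auto
  ultimately show ?thesis unfolding models_iff set_eq_iff Int_iff by blast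
qed

instance uword :: countable
  by countable_datatype

definition representative :: "identity set \<Rightarrow> uword \<Rightarrow> uword" where
  "representative \<theta> u = (SOME v. (u, v) \<in> \<theta>)"

text \<open>The free algebra of countable rank for a fully invariant congruence, with its elements
  coded in an arbitrary type by means of an injection of the set of words.\<close>

definition free_algebra :: "(uword \<Rightarrow> 'a) \<Rightarrow> identity set \<Rightarrow> 'a unary_alg" where
  "free_algebra f \<theta> =
     \<lparr>carrier = range (\<lambda>u. f (representative \<theta> u)),
      prd = (\<lambda>a b. f (representative \<theta> (Prod (inv_into UNIV f a) (inv_into UNIV f b)))),
      bar = (\<lambda>a. f (representative \<theta> (Bar (inv_into UNIV f a))))\<rparr>"

lemma free_algebra:
  fixes f :: "uword \<Rightarrow> 'a"
  assumes fi: "fully_invariant \<theta>" and f: "inj f"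
  shows "is_unary_alg (free_algebra f \<theta>)" "theory_of (free_algebra f \<theta>) = \<theta>"
    and "\<exists>h. range h \<subseteq> carrier (free_algebra f \<theta>) \<and>
      (\<forall>u v. word_val (free_algebra f \<theta>) h u = word_val (free_algebra f \<theta>) h v \<longrightarrow> (u, v) \<in> \<theta>)"
proof -
  have rep: "(u, representative \<theta> u) \<in> \<theta>" for u
    unfolding representative_def by (rule someI[of _ u]) (rule fi_refl[OF fi])
  have rep_eq: "representative \<theta> u = representative \<theta> v \<longleftrightarrow> (u, v) \<in> \<theta>" for u v
  proof
    assume "representative \<theta> u = representative \<theta> v"
    then show "(u, v) \<in> \<theta>" using rep[of u] rep[of v] by (metis fi fi_sym fi_trans)
  next
    assume "(u, v) \<in> \<theta>"
    then have "(u, w) \<in> \<theta> \<longleftrightarrow> (v, w) \<in> \<theta>" for w by (metis fi fi_sym fi_trans)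
    then show "representative \<theta> u = representative \<theta> v" by (simp add: representative_def)
  qed
  show "is_unary_alg (free_algebra f \<theta>)"
    by (auto simp: is_unary_alg_def free_algebra_def)
  have inv_f: "inv_into UNIV f (f u) = u" for u using f by simp
  have prd: "prd (free_algebra f \<theta>) (f (representative \<theta> u)) (f (representative \<theta> v))
      = f (representative \<theta> (Prod u v))" for u v
  proof -
    have "(Prod (representative \<theta> u) (representative \<theta> v), Prod u v) \<in> \<theta>"
      by (rule fi_Prod[OF fi fi_sym[OF fi rep] fi_sym[OF fi rep]])
    then show ?thesis unfolding rep_eq[symmetric] by (simp add: free_algebra_def inv_f)
  qed
  have bar: "bar (free_algebra f \<theta>) (f (representative \<theta> u))
      = f (representative \<theta> (Bar u))" for u
  proof -
    have "(Bar (representative \<theta> u), Bar u) \<in> \<theta>"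
      by (rule fi_Bar[OF fi fi_sym[OF fi rep]])
    then show ?thesis unfolding rep_eq[symmetric] by (simp add: free_algebra_def inv_f)
  qed
  have val: "word_val (free_algebra f \<theta>) (\<lambda>i. f (representative \<theta> (\<sigma> i))) u
      = f (representative \<theta> (substitute \<sigma> u))" for \<sigma> u
    by (induction u) (simp_all add: prd bar)
  let ?generic = "\<lambda>i. f (representative \<theta> (Letter i))"
  have carrier: "range ?generic \<subseteq> carrier (free_algebra f \<theta>)"
    by (auto simp: free_algebra_def)
  have generic: "(u, v) \<in> \<theta>"
    if "word_val (free_algebra f \<theta>) ?generic u = word_val (free_algebra f \<theta>) ?generic v" for u v
    using that f unfolding val by (simp add: inj_eq rep_eq)
  then show "\<exists>h. range h \<subseteq> carrier (free_algebra f \<theta>) \<and>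
      (\<forall>u v. word_val (free_algebra f \<theta>) h u = word_val (free_algebra f \<theta>) h v \<longrightarrow> (u, v) \<in> \<theta>)"
    using carrier by blast
  show "theory_of (free_algebra f \<theta>) = \<theta>"
  proof (intro equalityI subrelI)
    fix u v assume "(u, v) \<in> theory_of (free_algebra f \<theta>)"
    then show "(u, v) \<in> \<theta>" using theory_ofD carrier generic by blast
  next
    fix u v assume uv: "(u, v) \<in> \<theta>"
    show "(u, v) \<in> theory_of (free_algebra f \<theta>)"
      unfolding theory_of_def
    proof clarify
      fix h :: "nat \<Rightarrow> 'a" assume "range h \<subseteq> carrier (free_algebra f \<theta>)"
      then have "\<forall>i. \<exists>w. h i = f (representative \<theta> w)"
        by (auto simp: free_algebra_def image_subset_iff)
      then obtain \<sigma> where h: "h = (\<lambda>i. f (representative \<theta> (\<sigma> i)))" by metis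
      show "word_val (free_algebra f \<theta>) h u = word_val (free_algebra f \<theta>) h v"
        unfolding h val using fi_substitute[OF fi uv] by (simp add: inj_eq[OF f] rep_eq)
    qed
  qed
qed

lemma inj_uword:
  assumes "infinite (UNIV :: 'a set)"
  shows "\<exists>f :: uword \<Rightarrow> 'a. inj f"
proof -
  obtain g :: "nat \<Rightarrow> 'a" where "inj g"
    using infinite_countable_subset[OF assms] by auto
  then have "inj (g \<circ> (to_nat :: uword \<Rightarrow> nat))" by (simp add: inj_compose)
  then show ?thesis by blast
qed

lemma models_mono_iff:
  assumes inf: "infinite (UNIV :: 'a set)" and \<theta>: "fully_invariant \<theta>"
  shows "(models \<theta> :: 'a unary_alg set) \<subseteq> models \<eta> \<longleftrightarrow> \<eta> \<subseteq> \<theta>"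
proof
  obtain f :: "uword \<Rightarrow> 'a" where f: "inj f"
    using inj_uword[OF inf] by blast
  assume "(models \<theta> :: 'a unary_alg set) \<subseteq> models \<eta>"
  with free_algebra[OF \<theta> f] show "\<eta> \<subseteq> \<theta>" by (metis models_iff subsetD subset_refl)
next
  assume "\<eta> \<subseteq> \<theta>"
  then show "(models \<theta> :: 'a unary_alg set) \<subseteq> models \<eta>" by (simp add: models_iff subset_iff)
qed

text \<open>This direction of completeness turns calculations with elements into derivations of
  identities.\<close>

lemma in_theoryI:
  assumes \<theta>: "fully_invariant \<theta>"
    and *: "\<And>(S :: uword unary_alg) h. S \<in> models \<theta> \<Longrightarrow> range h \<subseteq> carrier S \<Longrightarrow>
              word_val S h u = word_val S h v"
  shows "(u, v) \<in> \<theta>"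
proof -
  note free = free_algebra[OF \<theta>, of id]
  have "free_algebra id \<theta> \<in> models \<theta>" using free by (simp add: models_iff)
  then have "(u, v) \<in> theory_of (free_algebra id \<theta>)" using * by (auto simp: theory_of_def)
  then show ?thesis using free by simp
qed

lemma theory_UNIV_I:
  assumes \<theta>: "fully_invariant \<theta>" and xy: "(Letter i, Letter j) \<in> \<theta>" "i \<noteq> j"
  shows "\<theta> = UNIV"
proof -
  have "(u, v) \<in> \<theta>" for u v
    using fi_substitute[OF \<theta> xy(1), of "\<lambda>k. if k = i then u else v"] xy(2) by simp
  then show ?thesis by auto
qed

section \<open>Epigroups as unary semigroups\<close>

text \<open>The elementary form of the epigroup axioms, which replaces maximal subgroups by the
  idempotent \<open>x \<cdot> bar x\<close>. Only the last axiom is not an identity: the exponent may depend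
  on the element.\<close>

locale epigroup_laws =
  fixes S :: "'a unary_alg"
  assumes nonempty: "carrier S \<noteq> {}"
    and closed: "x \<in> carrier S \<Longrightarrow> y \<in> carrier S \<Longrightarrow> prd S x y \<in> carrier S"
    and bar_closed: "x \<in> carrier S \<Longrightarrow> bar S x \<in> carrier S"
    and assoc: "x \<in> carrier S \<Longrightarrow> y \<in> carrier S \<Longrightarrow> z \<in> carrier S \<Longrightarrow>
      prd S (prd S x y) z = prd S x (prd S y z)"
    and bar_commute: "x \<in> carrier S \<Longrightarrow> prd S (bar S x) x = prd S x (bar S x)"
    and bar_regular: "x \<in> carrier S \<Longrightarrow> prd S (prd S (bar S x) x) (bar S x) = bar S x"
    and power_absorb: "x \<in> carrier S \<Longrightarrow>
      \<exists>n. prd S (pow_Suc S x n) (prd S x (bar S x)) = pow_Suc S x n"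
begin

abbreviation prd_syntax (infixl "\<cdot>" 70) where "x \<cdot> y \<equiv> prd S x y"

abbreviation pow :: "'a \<Rightarrow> nat \<Rightarrow> 'a" where "pow \<equiv> pow_Suc S"

abbreviation idem :: "'a \<Rightarrow> 'a" where "idem x \<equiv> x \<cdot> bar S x"

lemma is_unary_alg: "is_unary_alg S"
  using nonempty closed bar_closed by (simp add: is_unary_alg_def)

lemma pow_closed [simp]: "x \<in> carrier S \<Longrightarrow> pow x n \<in> carrier S"
  by (induction n) (simp_all add: closed)

lemma pow_add:
  "x \<in> carrier S \<Longrightarrow> pow x m \<cdot> pow x n = pow x (m + n + 1)"
  by (induction n) (simp_all add: assoc[symmetric] closed)

lemma assoc4:
  "a \<in> carrier S \<Longrightarrow> b \<in> carrier S \<Longrightarrow> c \<in> carrier S \<Longrightarrow> d \<in> carrier S \<Longrightarrow>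
    a \<cdot> b \<cdot> (c \<cdot> d) = a \<cdot> (b \<cdot> c) \<cdot> d"
  by (simp add: assoc closed)

lemma pow_commute:
  assumes "x \<in> carrier S" "y \<in> carrier S" "x \<cdot> y = y \<cdot> x"
  shows "y \<cdot> pow x n = pow x n \<cdot> y"
proof (induction n)
  case (Suc n)
  have "y \<cdot> (pow x n \<cdot> x) = (pow x n \<cdot> y) \<cdot> x"
    using assms Suc by (simp add: assoc[symmetric])
  also have "\<dots> = pow x n \<cdot> x \<cdot> y" using assms by (simp add: assoc)
  finally show ?case by simp
qed (use assms in simp)

lemma idem_commute: "x \<in> carrier S \<Longrightarrow> x \<cdot> idem x = idem x \<cdot> x"
  using bar_closed bar_commute by (metis assoc)

lemma idem_bar: "x \<in> carrier S \<Longrightarrow> idem x \<cdot> bar S x = bar S x"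
  using bar_regular bar_commute by simp

lemma bar_idem: "x \<in> carrier S \<Longrightarrow> bar S x \<cdot> idem x = bar S x"
  using bar_regular bar_closed by (metis assoc)

lemma idem_idempotent: "x \<in> carrier S \<Longrightarrow> idem x \<cdot> idem x = idem x"
  using assoc bar_closed bar_idem closed by simp

lemma power_absorb_mono:
  assumes x: "x \<in> carrier S" and n: "pow x n \<cdot> idem x = pow x n" and "n \<le> m"
  shows "pow x m \<cdot> idem x = pow x m"
  using \<open>n \<le> m\<close>
proof (induction m rule: dec_induct)
  case (step m)
  have "pow x (Suc m) \<cdot> idem x = pow x m \<cdot> (x \<cdot> idem x)"
    using x by (simp add: assoc closed bar_closed)
  also have "\<dots> = pow x m \<cdot> idem x \<cdot> x"
    using x idem_commute by (simp add: assoc closed bar_closed)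
  finally show ?case using step by simp
qed (rule n)

lemma idempotent_bar:
  assumes e: "e \<in> carrier S" "e \<cdot> e = e"
  shows "bar S e = e"
proof -
  have pow_e: "pow e n = e" for n by (induction n) (use e in auto)
  obtain n where "pow e n \<cdot> idem e = pow e n" using power_absorb[OF e(1)] by blast
  then have "e \<cdot> (e \<cdot> bar S e) = e" by (simp add: pow_e)
  then have 1: "e \<cdot> bar S e = e" using e by (metis assoc bar_closed)
  have "bar S e = e \<cdot> bar S e \<cdot> bar S e" using idem_bar e by simp
  then show ?thesis using 1 by simp
qed

text \<open>The maximal subgroup of an idempotent \<open>e\<close>.\<close>

definition unit_group :: "'a \<Rightarrow> 'a set" where
  "unit_group e = {a \<in> carrier S. a \<cdot> e = a \<and> e \<cdot> a = a \<and>
     (\<exists>b\<in>carrier S. b \<cdot> e = b \<and> e \<cdot> b = b \<and> a \<cdot> b = e \<and> b \<cdot> a = e)}"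

lemma maximal_subgroup_unit_group:
  assumes e: "e \<in> carrier S" "e \<cdot> e = e"
  shows "maximal_subgroup_of S (unit_group e) e"
proof -
  have "group (grp S (unit_group e) e)"
  proof (rule groupI, simp_all)
    fix a b assume a: "a \<in> unit_group e" and b: "b \<in> unit_group e"
    obtain a' where a': "a' \<in> carrier S" "a' \<cdot> e = a'" "e \<cdot> a' = a'" "a \<cdot> a' = e" "a' \<cdot> a = e"
      using a by (auto simp: unit_group_def)
    obtain b' where b': "b' \<in> carrier S" "b' \<cdot> e = b'" "e \<cdot> b' = b'" "b \<cdot> b' = e" "b' \<cdot> b = e"
      using b by (auto simp: unit_group_def)
    have ab: "a \<in> carrier S" "a \<cdot> e = a" "e \<cdot> a = a" "b \<in> carrier S" "b \<cdot> e = b" "e \<cdot> b = b"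
      using a b by (auto simp: unit_group_def)
    have inv: "a \<cdot> b \<cdot> (b' \<cdot> a') = e" "b' \<cdot> a' \<cdot> (a \<cdot> b) = e"
      using assoc4[of a b b' a'] assoc4[of b' a' a b] a' b' ab by simp_all
    have "a \<cdot> b \<cdot> e = a \<cdot> b" "e \<cdot> (a \<cdot> b) = a \<cdot> b" "b' \<cdot> a' \<cdot> e = b' \<cdot> a'"
      "e \<cdot> (b' \<cdot> a') = b' \<cdot> a'"
      using a' b' ab e assoc by simp_all (metis assoc)+
    with inv a' b' ab show "a \<cdot> b \<in> unit_group e"
      unfolding unit_group_def by (auto simp: closed)
    show "e \<cdot> a = a" using ab by simp
    have "a' \<in> unit_group e" using a' ab by (auto simp: unit_group_def)
    with a' show "\<exists>y\<in>unit_group e. y \<cdot> a = e" by blast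
  next
    show "e \<in> unit_group e" using e by (auto simp: unit_group_def)
  next
    fix a b c assume "a \<in> unit_group e" "b \<in> unit_group e" "c \<in> unit_group e"
    then show "a \<cdot> b \<cdot> c = a \<cdot> (b \<cdot> c)" by (simp add: unit_group_def assoc)
  qed
  moreover have "H = unit_group e" if H: "subgroup_of S H f" and sub: "unit_group e \<subseteq> H" for H f
  proof (rule equalityI[OF _ sub])
    interpret H: group "grp S H f" using H by (simp add: subgroup_of_def)
    have "e \<in> H" using sub e by (auto simp: unit_group_def)
    then have "e = f" using H.r_cancel_one[of e e] e by simp
    show "H \<subseteq> unit_group e"
    proof
      fix a assume a: "a \<in> H"
      obtain b where b: "b \<in> H" "b \<cdot> a = f" "a \<cdot> b = f"
        using H.l_inv H.r_inv H.inv_closed a by force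
      show "a \<in> unit_group e"
        unfolding unit_group_def \<open>e = f\<close>
        using a b H.l_one H.r_one H by (auto simp: subgroup_of_def)
    qed
  qed
  ultimately show ?thesis
    by (auto simp: maximal_subgroup_of_def subgroup_of_def unit_group_def)
qed

lemma pow_bar_inverse:
  assumes x: "x \<in> carrier S"
  shows "pow x n \<cdot> pow (bar S x) n = idem x"
proof (induction n)
  case (Suc n)
  have "x \<cdot> pow (bar S x) n = pow (bar S x) n \<cdot> x"
    using pow_commute[OF bar_closed[OF x] x] bar_commute[OF x] by simp
  then have "pow x (Suc n) \<cdot> pow (bar S x) (Suc n) = pow x n \<cdot> pow (bar S x) n \<cdot> idem x"
    using x bar_closed[OF x] by (simp add: assoc closed) (metis assoc pow_closed)
  then show ?case using Suc idem_idempotent x by simp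
qed simp

lemma epigroup: "epigroup S"
  unfolding epigroup_def
proof (intro conjI ballI)
  show "is_semigroup S" using nonempty closed assoc by (simp add: is_semigroup_def)
  fix x assume x: "x \<in> carrier S"
  define e where "e = idem x"
  have y: "bar S x \<in> carrier S" by (rule bar_closed[OF x])
  have e: "e \<in> carrier S" "e \<cdot> e = e"
    using x y idem_idempotent by (simp_all add: e_def closed)
  note max = maximal_subgroup_unit_group[OF e]
  obtain n where n: "pow x n \<cdot> e = pow x n" using power_absorb[OF x] by (auto simp: e_def)
  have "pow x n \<in> unit_group e"
  proof -
    have xe: "x \<cdot> e = e \<cdot> x" using idem_commute x by (simp add: e_def)
    have ey: "bar S x \<cdot> e = bar S x" "e \<cdot> bar S x = bar S x"
      using bar_idem idem_bar x by (simp_all add: e_def)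
    have "pow (bar S x) m \<cdot> e = pow (bar S x) m" for m
      by (induction m) (use ey y e in \<open>simp_all add: assoc\<close>)
    moreover have "e \<cdot> pow (bar S x) m = pow (bar S x) m" for m
      using pow_commute[OF y e(1)] ey calculation[of m] by simp
    moreover have "e \<cdot> pow x n = pow x n"
      using pow_commute[OF x e(1) xe] n by simp
    moreover have "pow x n \<cdot> pow (bar S x) n = e"
      using pow_bar_inverse[OF x] by (simp add: e_def)
    moreover have "pow (bar S x) n \<cdot> pow x n = e"
    proof -
      have "x \<cdot> pow (bar S x) n = pow (bar S x) n \<cdot> x"
        using pow_commute[OF y x] bar_commute[OF x] by simp
      then have "pow (bar S x) n \<cdot> pow x n = pow x n \<cdot> pow (bar S x) n"
        using pow_commute[OF x] y by simp
      then show ?thesis using \<open>pow x n \<cdot> pow (bar S x) n = e\<close> by simp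
    qed
    ultimately show ?thesis using x y n unfolding unit_group_def
      by (intro CollectI conjI bexI[of _ "pow (bar S x) n"]) simp_all
  qed
  moreover from max have "subgroup_of S (unit_group e) e"
    by (simp add: maximal_subgroup_of_def)
  ultimately show "\<exists>n G e. subgroup_of S G e \<and> pow_Suc S x n \<in> G" by blast
  interpret G: group "grp S (unit_group e) e"
    using \<open>subgroup_of S (unit_group e) e\<close> by (simp add: subgroup_of_def)
  have ye: "bar S x \<cdot> e = bar S x" "e \<cdot> bar S x = bar S x"
    using bar_idem idem_bar x by (simp_all add: e_def)
  have xe: "x \<cdot> e \<in> carrier S" "x \<cdot> e \<cdot> e = x \<cdot> e" "e \<cdot> (x \<cdot> e) = x \<cdot> e"
    using x e idem_commute[OF x] assoc[of e e x] by (simp_all add: closed assoc e_def[symmetric])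
  have inv: "x \<cdot> e \<cdot> bar S x = e" "bar S x \<cdot> (x \<cdot> e) = e"
    using x y e ye bar_commute[OF x] by (simp_all add: assoc e_def[symmetric]) (metis assoc e_def)
  have "x \<cdot> e \<in> unit_group e" "bar S x \<in> unit_group e"
    using xe inv ye y by (auto simp: unit_group_def)
  moreover from this inv have "bar S x = inv\<^bsub>grp S (unit_group e) e\<^esub> (x \<cdot> e)"
    using G.inv_equality[of "bar S x" "x \<cdot> e"] by simp
  ultimately show "is_pseudoinverse S x (bar S x)"
    unfolding is_pseudoinverse_def using max \<open>pow x n \<in> unit_group e\<close> by blast
qed

end

text \<open>Conversely, let \<open>G\<close> be the subgroup with unit \<open>e\<close> in the definition of the pseudoinverse
  \<open>y\<close> of \<open>x\<close>. If \<open>g\<close> is a power of \<open>x\<close> in \<open>G\<close>, then \<open>ex = g\<inverse>xg = g\<inverse>(xe)g\<close> is in \<open>G\<close> together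
  with \<open>xe\<close>. Hence \<open>xe = exe = ex\<close>, so \<open>x\<close> commutes with \<open>e\<close>, and \<open>xy = yx = e\<close>.\<close>

lemma epigroup_imp_laws:
  assumes S: "epigroup S"
  shows "epigroup_laws S"
proof
  have sg: "is_semigroup S" using S by (simp add: epigroup_def)
  then show "carrier S \<noteq> {}" by (simp add: is_semigroup_def)
  show closed: "prd S x y \<in> carrier S" if "x \<in> carrier S" "y \<in> carrier S" for x y
    using sg that by (simp add: is_semigroup_def)
  show assoc: "prd S (prd S x y) z = prd S x (prd S y z)"
    if "x \<in> carrier S" "y \<in> carrier S" "z \<in> carrier S" for x y z
    using sg that by (simp add: is_semigroup_def)
  have pow: "pow_Suc S x n \<in> carrier S" if "x \<in> carrier S" for x n
    by (induction n) (use that closed in auto)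
  have pow_comm: "prd S x (pow_Suc S x n) = prd S (pow_Suc S x n) x" if x: "x \<in> carrier S" for x n
  proof (induction n)
    case (Suc n)
    then show ?case using assoc[OF x pow[OF x] x, symmetric] by simp
  qed simp
  fix x assume x: "x \<in> carrier S"
  obtain G e n where G: "subgroup_of S G e" and g: "pow_Suc S x n \<in> G" and xe: "prd S x e \<in> G"
    and y: "bar S x = inv\<^bsub>grp S G e\<^esub> (prd S x e)"
    using S x unfolding epigroup_def is_pseudoinverse_def maximal_subgroup_of_def by metis
  interpret G: group "grp S G e" using G by (simp add: subgroup_of_def)
  have sub: "a \<in> carrier S" if "a \<in> G" for a using G that by (auto simp: subgroup_of_def)
  have e: "e \<in> G" using G.one_closed by simp
  have one: "prd S a e = a" "prd S e a = a" if "a \<in> G" for a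
    using G.l_one G.r_one that by auto
  have mult: "prd S a b \<in> G" if "a \<in> G" "b \<in> G" for a b
    using G.m_closed that by simp
  define g where "g = pow_Suc S x n"
  have gG: "g \<in> G" using g by (simp add: g_def)
  obtain h where h: "h \<in> G" "prd S h g = e"
    using G.l_inv G.inv_closed gG by force
  have "prd S e x = prd S h (prd S g x)"
    using h gG x sub by (metis assoc)
  also have "\<dots> = prd S h (prd S x (prd S e g))"
    using pow_comm[OF x] one gG by (simp add: g_def)
  also have "\<dots> = prd S (prd S h (prd S x e)) g"
    using h(1) gG x e xe sub by (simp add: assoc closed)
  also have "\<dots> \<in> G" using mult h(1) xe gG by blast
  finally have ex: "prd S e x \<in> G" .
  have comm: "prd S e x = prd S x e"
  proof -
    have "prd S e x = prd S (prd S e x) e" using one ex by simp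
    also have "\<dots> = prd S e (prd S x e)" using x sub[OF e] assoc by simp
    also have "\<dots> = prd S x e" using one xe by simp
    finally show ?thesis .
  qed
  have yG: "bar S x \<in> G" using y G.inv_closed xe by simp
  have inv: "prd S (bar S x) (prd S x e) = e" "prd S (prd S x e) (bar S x) = e"
    using G.l_inv G.r_inv xe by (auto simp: y)
  show "bar S x \<in> carrier S" using sub[OF yG] .
  have xy: "prd S x (bar S x) = e"
    using inv(2) one[OF yG] assoc[OF x sub[OF e] sub[OF yG]] by simp
  moreover have "prd S (bar S x) x = e"
    using inv(1) one[OF yG] assoc[OF sub[OF yG] sub[OF e] x] comm by simp
  ultimately show "prd S (bar S x) x = prd S x (bar S x)"
    and "prd S (prd S (bar S x) x) (bar S x) = bar S x"
    using one[OF yG] by simp_all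
  show "\<exists>n. prd S (pow_Suc S x n) (prd S x (bar S x)) = pow_Suc S x n"
    using one gG xy g_def by metis
qed

lemma epigroup_iff_laws: "epigroup S \<longleftrightarrow> epigroup_laws S"
  using epigroup_imp_laws epigroup_laws.epigroup by blast

section \<open>The lattice of epigroup varieties as a lattice of congruences\<close>

primrec power_word :: "uword \<Rightarrow> nat \<Rightarrow> uword" where
  "power_word u 0 = u"
| "power_word u (Suc n) = Prod (power_word u n) u"

lemma word_val_power_word [simp]:
  "word_val S h (power_word u n) = pow_Suc S (word_val S h u) n"
  by (induction n) auto

lemma substitute_power_word [simp]:
  "substitute \<sigma> (power_word u n) = power_word (substitute \<sigma> u) n"
  by (induction n) auto

definition epigroup_theory :: "identity set \<Rightarrow> bool" where
  "epigroup_theory \<theta> \<longleftrightarrow> fully_invariant \<theta> \<and>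
     (\<forall>u v w. (Prod (Prod u v) w, Prod u (Prod v w)) \<in> \<theta>) \<and>
     (\<forall>u. (Prod (Bar u) u, Prod u (Bar u)) \<in> \<theta>) \<and>
     (\<forall>u. (Prod (Prod (Bar u) u) (Bar u), Bar u) \<in> \<theta>) \<and>
     (\<exists>n. \<forall>u. (Prod (power_word u n) (Prod u (Bar u)), power_word u n) \<in> \<theta>)"

lemma epigroup_theory_fi: "epigroup_theory \<theta> \<Longrightarrow> fully_invariant \<theta>"
  by (simp add: epigroup_theory_def)

lemma epigroup_theory_assoc:
  "epigroup_theory \<theta> \<Longrightarrow> (Prod (Prod u v) w, Prod u (Prod v w)) \<in> \<theta>"
  by (simp add: epigroup_theory_def)

lemma epigroup_laws_models:
  assumes \<theta>: "epigroup_theory \<theta>" and S: "S \<in> models \<theta>"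
  shows "epigroup_laws S"
proof -
  have alg: "is_unary_alg S" using S by (simp add: models_iff)
  note ax = \<theta>[unfolded epigroup_theory_def]
  obtain n where n:
    "(Prod (power_word (Letter 0) n) (Prod (Letter 0) (Bar (Letter 0))), power_word (Letter 0) n) \<in> \<theta>"
    using ax by blast
  show ?thesis
  proof
    fix x assume x: "x \<in> carrier S"
    then have h: "range (\<lambda>_ :: nat. x) \<subseteq> carrier S" by auto
    have "(Prod (Bar (Letter 0)) (Letter 0), Prod (Letter 0) (Bar (Letter 0))) \<in> \<theta>"
      using ax by blast
    from modelsD[OF S this h] show "prd S (bar S x) x = prd S x (bar S x)" by simp
    have "(Prod (Prod (Bar (Letter 0)) (Letter 0)) (Bar (Letter 0)), Bar (Letter 0)) \<in> \<theta>"
      using ax by blast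
    from modelsD[OF S this h] show "prd S (prd S (bar S x) x) (bar S x) = bar S x" by simp
    from modelsD[OF S n h]
    show "\<exists>n. prd S (pow_Suc S x n) (prd S x (bar S x)) = pow_Suc S x n" by auto
    fix y z assume y: "y \<in> carrier S" and z: "z \<in> carrier S"
    let ?h = "\<lambda>i :: nat. if i = 0 then x else if i = 1 then y else z"
    have h: "range ?h \<subseteq> carrier S" using x y z by auto
    have "(Prod (Prod (Letter 0) (Letter 1)) (Letter 2), Prod (Letter 0) (Prod (Letter 1) (Letter 2))) \<in> \<theta>"
      using ax by blast
    from modelsD[OF S this h] show "prd S (prd S x y) z = prd S x (prd S y z)" by simp
  qed (use alg in \<open>auto simp: is_unary_alg_def\<close>)
qed

lemma theory_of_epigroup_laws:
  assumes "epigroup_laws S" "range h \<subseteq> carrier S"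
  shows "word_val S h (Prod (Prod u v) w) = word_val S h (Prod u (Prod v w))"
    and "word_val S h (Prod (Bar u) u) = word_val S h (Prod u (Bar u))"
    and "word_val S h (Prod (Prod (Bar u) u) (Bar u)) = word_val S h (Bar u)"
proof -
  interpret epigroup_laws S by (rule assms)
  have "word_val S h u \<in> carrier S" for u by (rule word_val_in_carrier[OF is_unary_alg assms(2)])
  then show "word_val S h (Prod (Prod u v) w) = word_val S h (Prod u (Prod v w))"
    and "word_val S h (Prod (Bar u) u) = word_val S h (Prod u (Bar u))"
    and "word_val S h (Prod (Prod (Bar u) u) (Bar u)) = word_val S h (Bar u)"
    using assoc bar_commute bar_regular by auto
qed

text \<open>The exponent that the generic element of the free algebra needs serves all elements of all
  members of a variety.\<close>

lemma epigroup_variety_models_iff: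
  assumes inf: "infinite (UNIV :: 'a set)" and \<theta>: "fully_invariant \<theta>"
  shows "epigroup_variety (models \<theta> :: 'a unary_alg set) \<longleftrightarrow> epigroup_theory \<theta>"
proof
  assume ev: "epigroup_variety (models \<theta> :: 'a unary_alg set)"
  obtain f :: "uword \<Rightarrow> 'a" where f: "inj f" using inj_uword[OF inf] by blast
  define S where "S = free_algebra f \<theta>"
  note free = free_algebra[OF \<theta> f, folded S_def]
  have "S \<in> models \<theta>" using free by (simp add: models_iff)
  then have laws: "epigroup_laws S"
    using ev by (simp add: epigroup_variety_def epigroup_iff_laws)
  note th = theory_of_epigroup_laws[OF laws]
  interpret epigroup_laws S by (rule laws)
  obtain h where h: "range h \<subseteq> carrier S"
    and generic: "\<And>u v. word_val S h u = word_val S h v \<Longrightarrow> (u, v) \<in> \<theta>"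
    using free(3) by blast
  have "h 0 \<in> carrier S" using h by auto
  then obtain n where "prd S (pow_Suc S (h 0) n) (prd S (h 0) (bar S (h 0))) = pow_Suc S (h 0) n"
    using power_absorb by blast
  then have "(Prod (power_word (Letter 0) n) (Prod (Letter 0) (Bar (Letter 0))),
      power_word (Letter 0) n) \<in> \<theta>"
    by (intro generic) simp
  from fi_substitute[OF \<theta> this, of "\<lambda>_. u" for u]
  have "(Prod (power_word u n) (Prod u (Bar u)), power_word u n) \<in> \<theta>" for u by simp
  then show "epigroup_theory \<theta>"
    unfolding epigroup_theory_def using \<theta> generic th[OF h] by blast
next
  assume "epigroup_theory \<theta>"
  then show "epigroup_variety (models \<theta> :: 'a unary_alg set)"
    by (auto simp: epigroup_variety_def variety_def models_def epigroup_iff_laws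
        intro: epigroup_laws_models)
qed

lemma epigroup_theory_power_absorb:
  assumes \<theta>: "epigroup_theory \<theta>"
  shows "\<exists>n. \<forall>m\<ge>n. \<forall>u. (Prod (power_word u m) (Prod u (Bar u)), power_word u m) \<in> \<theta>"
proof -
  obtain n where n: "\<And>u. (Prod (power_word u n) (Prod u (Bar u)), power_word u n) \<in> \<theta>"
    using \<theta> unfolding epigroup_theory_def by blast
  have "(Prod (power_word u m) (Prod u (Bar u)), power_word u m) \<in> \<theta>" if "m \<ge> n" for m u
  proof (rule in_theoryI[OF epigroup_theory_fi[OF \<theta>]])
    fix S :: "uword unary_alg" and h :: "nat \<Rightarrow> uword"
    assume S: "S \<in> models \<theta>" and h: "range h \<subseteq> carrier S"
    interpret epigroup_laws S using epigroup_laws_models[OF \<theta> S] .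
    have "word_val S h u \<in> carrier S" using word_val_in_carrier[OF is_unary_alg h] .
    with modelsD[OF S n[of u] h] \<open>m \<ge> n\<close>
    show "word_val S h (Prod (power_word u m) (Prod u (Bar u))) = word_val S h (power_word u m)"
      using power_absorb_mono by simp
  qed
  then show ?thesis by blast
qed

lemma epigroup_theory_Inter:
  assumes \<theta>: "epigroup_theory \<theta>" and \<eta>: "epigroup_theory \<eta>"
  shows "epigroup_theory (\<theta> \<inter> \<eta>)"
proof -
  obtain m where m: "\<And>k u. k \<ge> m \<Longrightarrow>
      (Prod (power_word u k) (Prod u (Bar u)), power_word u k) \<in> \<theta>"
    using epigroup_theory_power_absorb[OF \<theta>] by blast
  obtain n where n: "\<And>k u. k \<ge> n \<Longrightarrow>
      (Prod (power_word u k) (Prod u (Bar u)), power_word u k) \<in> \<eta>"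
    using epigroup_theory_power_absorb[OF \<eta>] by blast
  have "(Prod (power_word u (max m n)) (Prod u (Bar u)), power_word u (max m n)) \<in> \<theta> \<inter> \<eta>" for u
    using m n by simp
  moreover have "fully_invariant (\<theta> \<inter> \<eta>)"
    using \<theta> \<eta> by (simp add: epigroup_theory_fi fully_invariant_Inter)
  ultimately show ?thesis using \<theta> \<eta> unfolding epigroup_theory_def by blast
qed

lemma epigroup_theory_mono:
  assumes "epigroup_theory \<theta>" "\<theta> \<subseteq> \<eta>" "fully_invariant \<eta>"
  shows "epigroup_theory \<eta>"
  using assms unfolding epigroup_theory_def by (meson subsetD)

lemma epigroup_theory_rtrancl:
  assumes "epigroup_theory \<theta>" "epigroup_theory \<eta>"
  shows "epigroup_theory ((\<theta> \<union> \<eta>)\<^sup>*)"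
  by (rule epigroup_theory_mono[OF assms(1)])
    (use assms in \<open>auto intro: fully_invariant_rtrancl epigroup_theory_fi\<close>)

lemma fully_invariant_theory_of_class:
  "\<forall>S\<in>V. is_unary_alg S \<Longrightarrow> fully_invariant (\<Inter>S\<in>V. theory_of S)"
proof (rule fully_invariantI)
  fix u v w assume "\<forall>S\<in>V. is_unary_alg S" "(u, v) \<in> (\<Inter>S\<in>V. theory_of S)"
    "(v, w) \<in> (\<Inter>S\<in>V. theory_of S)"
  then show "(u, w) \<in> (\<Inter>S\<in>V. theory_of S)"
    by (auto simp: theory_of_def)
next
  fix u v assume "(u, v) \<in> (\<Inter>S\<in>V. theory_of S)"
  then show "(v, u) \<in> (\<Inter>S\<in>V. theory_of S)" by (auto simp: theory_of_def)
qed (simp_all add: fi_refl fi_Prod fi_Bar fi_substitute fully_invariant_theory_of)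

text \<open>Epigroup varieties correspond to their equational theories, in reverse order. The theory
  of a meet is the join of the theories, and the theory of a join is their intersection.\<close>

lemma EPI_eq:
  assumes inf: "infinite (UNIV :: 'a set)"
  shows "(EPI :: 'a unary_alg set set) = models ` {\<theta>. epigroup_theory \<theta>}"
proof (intro equalityI subsetI)
  fix V :: "'a unary_alg set" assume "V \<in> EPI"
  then have ev: "epigroup_variety V" by (simp add: EPI_def)
  then obtain \<Sigma> where \<Sigma>: "V = models \<Sigma>"
    by (auto simp: epigroup_variety_def variety_def models_def)
  let ?\<theta> = "\<Inter>S\<in>V. theory_of S"
  have "\<Sigma> \<subseteq> ?\<theta>" unfolding \<Sigma> by (auto simp: models_iff)
  then have "V = models ?\<theta>"
    unfolding \<Sigma> by (fastforce simp: models_iff)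
  moreover have "fully_invariant ?\<theta>"
    by (rule fully_invariant_theory_of_class) (auto simp: \<Sigma> models_iff)
  ultimately show "V \<in> models ` {\<theta>. epigroup_theory \<theta>}"
    using epigroup_variety_models_iff[OF inf] ev by (metis image_eqI mem_Collect_eq)
next
  fix V :: "'a unary_alg set" assume "V \<in> models ` {\<theta>. epigroup_theory \<theta>}"
  then show "V \<in> EPI"
    using epigroup_variety_models_iff[OF inf] epigroup_theory_fi by (auto simp: EPI_def)
qed

lemma models_eq_iff:
  assumes inf: "infinite (UNIV :: 'a set)" and "epigroup_theory \<theta>" "epigroup_theory \<eta>"
  shows "(models \<theta> :: 'a unary_alg set) = models \<eta> \<longleftrightarrow> \<theta> = \<eta>"
  using models_mono_iff[OF inf] assms(2,3) epigroup_theory_fi by blast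

lemma epi_meet_models: "epi_meet (models \<theta>) (models \<eta>) = models ((\<theta> \<union> \<eta>)\<^sup>*)"
  by (simp add: epi_meet_def models_rtrancl)

lemma epi_join_models:
  assumes inf: "infinite (UNIV :: 'a set)" and \<theta>: "epigroup_theory \<theta>" and \<eta>: "epigroup_theory \<eta>"
  shows "epi_join (models \<theta>) (models \<eta>) = (models (\<theta> \<inter> \<eta>) :: 'a unary_alg set)"
  unfolding epi_join_def
proof (rule Least_equality)
  note mono = models_mono_iff[OF inf]
  note fi = epigroup_theory_fi[OF \<theta>] epigroup_theory_fi[OF \<eta>]
  note \<theta>\<eta> = epigroup_theory_Inter[OF \<theta> \<eta>]
  show "epigroup_variety (models (\<theta> \<inter> \<eta>) :: 'a unary_alg set) \<and>
      (models \<theta> :: 'a unary_alg set) \<subseteq> models (\<theta> \<inter> \<eta>) \<and>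
      (models \<eta> :: 'a unary_alg set) \<subseteq> models (\<theta> \<inter> \<eta>)"
    using epigroup_variety_models_iff[OF inf epigroup_theory_fi[OF \<theta>\<eta>]] \<theta>\<eta>
    by (simp add: mono fi)
  fix Z :: "'a unary_alg set"
  assume Z: "epigroup_variety Z \<and> models \<theta> \<subseteq> Z \<and> models \<eta> \<subseteq> Z"
  then have "Z \<in> models ` {\<theta>. epigroup_theory \<theta>}"
    using EPI_eq[OF inf] by (metis EPI_def mem_Collect_eq)
  then obtain \<zeta> where \<zeta>: "Z = models \<zeta>" "epigroup_theory \<zeta>" by blast
  show "models (\<theta> \<inter> \<eta>) \<subseteq> Z"
    using Z mono fi epigroup_theory_fi[OF \<theta>\<eta>] unfolding \<zeta>(1) by simp
qed

section \<open>Words and zeros\<close>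

text \<open>The word of letters that a term represents. It is undefined for terms in which \<open>Bar\<close>
  occurs, since these are zero in a nil variety.\<close>

primrec flat :: "uword \<Rightarrow> nat list option" where
  "flat (Letter i) = Some [i]"
| "flat (Prod u v) =
     (case flat u of None \<Rightarrow> None | Some a \<Rightarrow> map_option (append a) (flat v))"
| "flat (Bar u) = None"

lemma flat_nonempty: "flat u \<noteq> Some []"
  by (induction u) (auto split: option.splits)

definition substitute_list :: "(nat \<Rightarrow> uword) \<Rightarrow> nat list \<Rightarrow> nat list option" where
  "substitute_list \<sigma> w =
     (if \<forall>i\<in>set w. flat (\<sigma> i) \<noteq> None
      then Some (concat (map (\<lambda>i. the (flat (\<sigma> i))) w)) else None)"

lemma flat_substitute:
  "flat (substitute \<sigma> u) = Option.bind (flat u) (substitute_list \<sigma>)"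
proof (induction u)
  case (Prod u v)
  then show ?case
    by (cases "flat u"; cases "flat v") (auto simp: substitute_list_def split: option.split)
qed (auto simp: substitute_list_def)

lemma flat_Prod_cong:
  "flat u = flat u' \<Longrightarrow> flat v = flat v' \<Longrightarrow> flat (Prod u v) = flat (Prod u' v')"
  by (simp split: option.split)

lemma flat_assoc: "flat (Prod (Prod u v) w) = flat (Prod u (Prod v w))"
  by (cases "flat u"; cases "flat v"; cases "flat w") auto

primrec append_letters :: "uword \<Rightarrow> nat list \<Rightarrow> uword" where
  "append_letters u [] = u"
| "append_letters u (j # w) = append_letters (Prod u (Letter j)) w"

lemma append_letters_append:
  "append_letters u (v @ w) = append_letters (append_letters u v) w"
  by (induction v arbitrary: u) auto

text \<open>Every term without \<open>Bar\<close> can be rebracketed to the left.\<close>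

lemma related_if_flat_eq:
  assumes fi: "fully_invariant \<theta>"
    and assoc: "\<And>u v w. (Prod (Prod u v) w, Prod u (Prod v w)) \<in> \<theta>"
    and uv: "flat u = flat v" "flat u \<noteq> None"
  shows "(u, v) \<in> \<theta>"
proof -
  have cong: "(append_letters u w, append_letters u' w) \<in> \<theta>" if "(u, u') \<in> \<theta>" for u u' w
    using that by (induction w arbitrary: u u') (auto intro: fi_Prod[OF fi] fi_refl[OF fi])
  have absorb: "(Prod u v, append_letters u w) \<in> \<theta>" if "flat v = Some w" for u v w
    using that
  proof (induction v arbitrary: u w)
    case (Prod v1 v2)
    then obtain w1 w2 where w: "flat v1 = Some w1" "flat v2 = Some w2" "w = w1 @ w2"
      by (auto split: option.splits)
    have "(Prod u (Prod v1 v2), Prod (Prod u v1) v2) \<in> \<theta>"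
      by (rule fi_sym[OF fi assoc])
    moreover have "(Prod (Prod u v1) v2, append_letters (Prod u v1) w2) \<in> \<theta>"
      by (rule Prod.IH(2)[OF w(2)])
    moreover have "(append_letters (Prod u v1) w2, append_letters (append_letters u w1) w2) \<in> \<theta>"
      by (rule cong[OF Prod.IH(1)[OF w(1)]])
    ultimately show ?case
      using fi_trans[OF fi] w(3) append_letters_append by metis
  qed (auto intro: fi_refl[OF fi])
  have canonical: "(v, append_letters (Letter (hd w)) (tl w)) \<in> \<theta>" if "flat v = Some w" for v w
    using that
  proof (induction v arbitrary: w)
    case (Prod v1 v2)
    then obtain w1 w2 where w: "flat v1 = Some w1" "flat v2 = Some w2" "w = w1 @ w2"
      by (auto split: option.splits)
    have "(Prod v1 v2, append_letters v1 w2) \<in> \<theta>" by (rule absorb[OF w(2)])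
    moreover have "(append_letters v1 w2, append_letters (append_letters (Letter (hd w1)) (tl w1)) w2) \<in> \<theta>"
      by (rule cong[OF Prod.IH(1)[OF w(1)]])
    moreover have "hd w = hd w1" "tl w = tl w1 @ w2"
      using w flat_nonempty[of v1] by auto
    ultimately show ?case
      using fi_trans[OF fi] append_letters_append by metis
  qed (auto intro: fi_refl[OF fi])
  show ?thesis
    using canonical uv fi_trans[OF fi] fi_sym[OF fi] by (metis not_None_eq)
qed

lemma in_theory_if_flat_eq:
  "epigroup_theory \<theta> \<Longrightarrow> flat u = flat v \<Longrightarrow> flat u \<noteq> None \<Longrightarrow> (u, v) \<in> \<theta>"
  using related_if_flat_eq epigroup_theory_fi epigroup_theory_assoc by blast

text \<open>Theories of nil varieties: all words in \<open>K\<close> are zero, and the only other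
  consequences beyond associativity are the pairs in \<open>D\<close>.\<close>

definition nil_theory :: "uword set \<Rightarrow> identity set \<Rightarrow> identity set" where
  "nil_theory K D = {(p, q). flat p = flat q \<or> p \<in> K \<and> q \<in> K \<or> (p, q) \<in> D}"

text \<open>By \<open>D_ideal\<close> the words in the pairs lie just above the zero, so that nothing follows from
  multiplying a pair; by \<open>D_unique\<close> a nonzero class consists of at most two words of letters.\<close>

lemma epigroup_theory_nil_theory:
  assumes K_flat: "\<And>p q. flat p = flat q \<Longrightarrow> p \<in> K \<Longrightarrow> q \<in> K"
    and K_Bar: "\<And>p. flat p = None \<Longrightarrow> p \<in> K"
    and K_left: "\<And>p r. p \<in> K \<Longrightarrow> Prod r p \<in> K"
    and K_right: "\<And>p r. p \<in> K \<Longrightarrow> Prod p r \<in> K"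
    and K_substitute: "\<And>p \<sigma>. p \<in> K \<Longrightarrow> substitute \<sigma> p \<in> K"
    and K_power: "\<exists>n. \<forall>u. power_word u n \<in> K"
    and D_sym: "\<And>p q. (p, q) \<in> D \<Longrightarrow> (q, p) \<in> D"
    and D_flat: "\<And>p q r. flat p = flat q \<Longrightarrow> (p, r) \<in> D \<Longrightarrow> (q, r) \<in> D"
    and D_unique: "\<And>p q r. (p, q) \<in> D \<Longrightarrow> (q, r) \<in> D \<Longrightarrow> flat p = flat r"
    and D_nonzero: "\<And>p q. (p, q) \<in> D \<Longrightarrow> p \<notin> K"
    and D_ideal: "\<And>p q r. (p, q) \<in> D \<Longrightarrow> Prod p r \<in> K \<and> Prod r p \<in> K"
    and D_substitute: "\<And>p q \<sigma>. (p, q) \<in> D \<Longrightarrow>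
      (substitute \<sigma> p, substitute \<sigma> q) \<in> D \<or> substitute \<sigma> p \<in> K \<and> substitute \<sigma> q \<in> K"
  shows "epigroup_theory (nil_theory K D)"
  unfolding epigroup_theory_def
proof (intro conjI allI)
  show "fully_invariant (nil_theory K D)"
  proof (rule fully_invariantI)
    fix u v w assume uv: "(u, v) \<in> nil_theory K D" and vw: "(v, w) \<in> nil_theory K D"
    consider "flat u = flat v" | "u \<in> K" "v \<in> K" | "(u, v) \<in> D"
      using uv unfolding nil_theory_def by blast
    moreover consider "flat v = flat w" | "v \<in> K" "w \<in> K" | "(v, w) \<in> D"
      using vw unfolding nil_theory_def by blast
    ultimately have "flat u = flat w \<or> u \<in> K \<and> w \<in> K \<or> (u, w) \<in> D"
      using K_flat D_flat D_sym D_unique D_nonzero by (metis (no_types))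
    then show "(u, w) \<in> nil_theory K D" by (simp add: nil_theory_def)
  next
    fix u v assume "(u, v) \<in> nil_theory K D"
    then have "flat u = flat v \<or> u \<in> K \<and> v \<in> K \<or> (u, v) \<in> D" by (simp add: nil_theory_def)
    then have "flat v = flat u \<or> v \<in> K \<and> u \<in> K \<or> (v, u) \<in> D" using D_sym by metis
    then show "(v, u) \<in> nil_theory K D" by (simp add: nil_theory_def)
  next
    fix u v w assume "(u, v) \<in> nil_theory K D"
    then have "flat u = flat v \<or> u \<in> K \<and> v \<in> K \<or> (u, v) \<in> D" by (simp add: nil_theory_def)
    then have "flat (Prod u w) = flat (Prod v w) \<or> Prod u w \<in> K \<and> Prod v w \<in> K"
      and "flat (Prod w u) = flat (Prod w v) \<or> Prod w u \<in> K \<and> Prod w v \<in> K"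
      using K_left K_right D_ideal D_sym flat_Prod_cong by (metis (no_types))+
    then show "(Prod u w, Prod v w) \<in> nil_theory K D" "(Prod w u, Prod w v) \<in> nil_theory K D"
      by (auto simp: nil_theory_def)
  next
    fix u v \<sigma> assume "(u, v) \<in> nil_theory K D"
    then have "flat u = flat v \<or> u \<in> K \<and> v \<in> K \<or> (u, v) \<in> D" by (simp add: nil_theory_def)
    then have "flat (substitute \<sigma> u) = flat (substitute \<sigma> v) \<or>
        substitute \<sigma> u \<in> K \<and> substitute \<sigma> v \<in> K \<or> (substitute \<sigma> u, substitute \<sigma> v) \<in> D"
      using K_substitute D_substitute flat_substitute by (metis (no_types))
    then show "(substitute \<sigma> u, substitute \<sigma> v) \<in> nil_theory K D"
      by (simp add: nil_theory_def)
  qed (auto simp: nil_theory_def)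
  obtain n where "\<And>u. power_word u n \<in> K" using K_power by blast
  then show "\<exists>n. \<forall>u. (Prod (power_word u n) (Prod u (Bar u)), power_word u n) \<in> nil_theory K D"
    using K_right by (auto simp: nil_theory_def)
  show "(Prod (Prod u v) w, Prod u (Prod v w)) \<in> nil_theory K D" for u v w
    unfolding nil_theory_def using flat_assoc by blast
qed (auto simp: nil_theory_def split: option.splits)

definition zeros :: "identity set \<Rightarrow> uword set" where
  "zeros \<theta> = {p. \<forall>r. (Prod p r, p) \<in> \<theta> \<and> (Prod r p, p) \<in> \<theta>}"

text \<open>If \<open>bar x = 0\<close>, then \<open>x^n = x^n x (bar x)\<close> is zero as well.\<close>

definition nil :: "identity set \<Rightarrow> bool" where
  "nil \<theta> \<longleftrightarrow> Bar (Letter 0) \<in> zeros \<theta>"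

lemma substitute_fresh:
  "x \<notin> letters p \<Longrightarrow> substitute (\<sigma>(x := r)) p = substitute \<sigma> p"
  by (rule substitute_cong) auto

context
  fixes \<theta> assumes fi: "fully_invariant \<theta>"
begin

lemma zeros_related: "p \<in> zeros \<theta> \<Longrightarrow> q \<in> zeros \<theta> \<Longrightarrow> (p, q) \<in> \<theta>"
  unfolding zeros_def using fi_trans[OF fi] fi_sym[OF fi] by blast

lemma zeros_closed:
  assumes "p \<in> zeros \<theta>" "(p, q) \<in> \<theta>"
  shows "q \<in> zeros \<theta>"
proof -
  have "(Prod q r, Prod p r) \<in> \<theta>" "(Prod r q, Prod r p) \<in> \<theta>" for r
    using assms(2) by (auto intro: fi_Prod[OF fi] fi_sym[OF fi] fi_refl[OF fi])
  then show ?thesis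
    using assms unfolding zeros_def mem_Collect_eq using fi_trans[OF fi] by blast
qed

lemma zeros_Prod:
  assumes "p \<in> zeros \<theta>"
  shows "Prod p r \<in> zeros \<theta>" "Prod r p \<in> zeros \<theta>"
  using assms zeros_closed[OF assms] fi_sym[OF fi] unfolding zeros_def by auto

lemma eq_zero_subset_iff: "eq_zero p \<subseteq> \<theta> \<longleftrightarrow> p \<in> zeros \<theta>"
proof
  assume z: "eq_zero p \<subseteq> \<theta>"
  obtain x where x: "x \<notin> letters p" using ex_new_if_finite[OF infinite_UNIV_nat finite_letters] by blast
  have "substitute (Letter(x := r)) p = p" for r
    using substitute_fresh[OF x] by simp
  moreover have "(Prod p (Letter x), p) \<in> \<theta>" "(Prod (Letter x) p, p) \<in> \<theta>"
    using z x by (auto simp: eq_zero_def)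
  ultimately show "p \<in> zeros \<theta>"
    unfolding zeros_def mem_Collect_eq
    using fi_substitute[OF fi, of "Prod p (Letter x)" p "Letter(x := r)" for r]
      fi_substitute[OF fi, of "Prod (Letter x) p" p "Letter(x := r)" for r] by simp
qed (auto simp: eq_zero_def zeros_def)

lemma zeros_substitute:
  assumes p: "p \<in> zeros \<theta>"
  shows "substitute \<sigma> p \<in> zeros \<theta>"
proof -
  obtain x where x: "x \<notin> letters p" using ex_new_if_finite[OF infinite_UNIV_nat finite_letters] by blast
  have s: "substitute (\<sigma>(x := r)) p = substitute \<sigma> p" for r
    using substitute_fresh[OF x] .
  have "(Prod p (Letter x), p) \<in> \<theta>" "(Prod (Letter x) p, p) \<in> \<theta>"
    using p by (auto simp: zeros_def)
  from this[THEN fi_substitute[OF fi, of _ _ "\<sigma>(x := r)" for r]]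
  show ?thesis by (simp add: zeros_def s)
qed

lemma nil_imp_zeros:
  assumes "nil \<theta>" "flat p = None"
  shows "p \<in> zeros \<theta>"
  using assms(2)
proof (induction p)
  case (Bar p)
  show ?case using zeros_substitute[of "Bar (Letter 0)" "\<lambda>_. p"] assms(1) by (simp add: nil_def)
qed (auto intro: zeros_Prod split: option.splits)

end

lemma zeros_mono: "\<theta> \<subseteq> \<eta> \<Longrightarrow> zeros \<theta> \<subseteq> zeros \<eta>"
  by (auto simp: zeros_def)

lemma zeros_Inter: "zeros (\<theta> \<inter> \<eta>) = zeros \<theta> \<inter> zeros \<eta>"
  by (auto simp: zeros_def)

lemma nil_imp_power_zero:
  assumes \<theta>: "epigroup_theory \<theta>" and nil: "nil \<theta>"
  shows "\<exists>n. \<forall>u. power_word u n \<in> zeros \<theta>"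
proof -
  note fi = epigroup_theory_fi[OF \<theta>]
  obtain n where "\<And>u. (Prod (power_word u n) (Prod u (Bar u)), power_word u n) \<in> \<theta>"
    using \<theta> unfolding epigroup_theory_def by blast
  moreover have "Prod (power_word u n) (Prod u (Bar u)) \<in> zeros \<theta>" for u
    by (rule nil_imp_zeros[OF fi nil]) (simp split: option.split)
  ultimately show ?thesis using zeros_closed[OF fi] by blast
qed

section \<open>Theories of 0-reduced varieties\<close>

definition zero_reduced_theory :: "identity set \<Rightarrow> bool" where
  "zero_reduced_theory \<theta> \<longleftrightarrow> epigroup_theory \<theta> \<and> nil \<theta> \<and>
     (\<forall>(p, q)\<in>\<theta>. p \<in> zeros \<theta> \<or> flat p = flat q)"

text \<open>The theory of the 0-reduced variety with the same zeros.\<close>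

abbreviation zero_hull :: "identity set \<Rightarrow> identity set" where
  "zero_hull \<theta> \<equiv> nil_theory (zeros \<theta>) {}"

lemma zeros_flat:
  assumes \<theta>: "epigroup_theory \<theta>" and nil: "nil \<theta>" and "flat p = flat q" "p \<in> zeros \<theta>"
  shows "q \<in> zeros \<theta>"
proof (cases "flat q = None")
  case False
  then show ?thesis
    using assms epigroup_theory_fi in_theory_if_flat_eq zeros_closed by metis
qed (use nil_imp_zeros[OF epigroup_theory_fi[OF \<theta>] nil] in blast)

lemma epigroup_theory_zero_hull:
  assumes \<theta>: "epigroup_theory \<theta>" and nil: "nil \<theta>"
  shows "epigroup_theory (zero_hull \<theta>)"
proof -
  note fi = epigroup_theory_fi[OF \<theta>]
  show ?thesis
  proof (rule epigroup_theory_nil_theory)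
    show "q \<in> zeros \<theta>" if "flat p = flat q" "p \<in> zeros \<theta>" for p q
      by (rule zeros_flat[OF \<theta> nil that])
  qed (simp_all add: nil_imp_zeros[OF fi nil] zeros_Prod[OF fi] zeros_substitute[OF fi]
      nil_imp_power_zero[OF \<theta> nil])
qed

lemma zero_hull_subset:
  assumes \<theta>: "epigroup_theory \<theta>" and nil: "nil \<theta>"
  shows "zero_hull \<theta> \<subseteq> \<theta>"
proof clarify
  note fi = epigroup_theory_fi[OF \<theta>]
  fix p q assume "(p, q) \<in> zero_hull \<theta>"
  then show "(p, q) \<in> \<theta>"
    using zeros_related[OF fi] nil_imp_zeros[OF fi nil] in_theory_if_flat_eq[OF \<theta>]
    unfolding nil_theory_def by (metis (mono_tags, lifting) case_prodD empty_iff mem_Collect_eq)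
qed

text \<open>The variety of all semigroups in which products of more than \<open>M\<close> factors are zero.\<close>

definition long_words :: "nat \<Rightarrow> uword set" where
  "long_words M = {p. case flat p of None \<Rightarrow> True | Some w \<Rightarrow> M < length w}"

definition nilpotent :: "nat \<Rightarrow> identity set" where
  "nilpotent M = nil_theory (long_words M) {}"

lemma length_flat_power_word:
  "flat (power_word u n) = Some w \<Longrightarrow> n < length w"
proof (induction n arbitrary: w)
  case 0
  then show ?case using flat_nonempty by auto
next
  case (Suc n)
  then obtain a b where "flat (power_word u n) = Some a" "flat u = Some b" "w = a @ b"
    by (auto split: option.splits)
  then show ?case using Suc.IH flat_nonempty[of u] by (cases b) fastforce+
qed

lemma length_concat_ge:
  "(\<And>i. i \<in> set w \<Longrightarrow> f i \<noteq> []) \<Longrightarrow> length w \<le> length (concat (map f w))"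
proof (induction w)
  case (Cons i w)
  then have "f i \<noteq> []" "length w \<le> length (concat (map f w))" by auto
  then show ?case by (cases "f i") auto
qed simp

lemma long_words_iff: "p \<in> long_words M \<longleftrightarrow> (\<forall>w. flat p = Some w \<longrightarrow> M < length w)"
  by (simp add: long_words_def split: option.split)

lemma long_words_substitute:
  assumes p: "p \<in> long_words M"
  shows "substitute \<sigma> p \<in> long_words M"
  unfolding long_words_iff
proof (intro allI impI)
  fix w' assume "flat (substitute \<sigma> p) = Some w'"
  then obtain w where w: "flat p = Some w" "substitute_list \<sigma> w = Some w'"
    by (auto simp: flat_substitute bind_eq_Some_conv)
  have "length w \<le> length w'"
    using w(2) length_concat_ge[of w "\<lambda>i. the (flat (\<sigma> i))"] flat_nonempty
    by (fastforce simp: substitute_list_def split: if_splits)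
  then show "M < length w'" using p w(1) by (auto simp: long_words_iff)
qed

lemma long_words_power: "power_word u M \<in> long_words M"
  using length_flat_power_word by (simp add: long_words_iff)

lemma long_words_Prod:
  "p \<in> long_words M \<Longrightarrow> Prod p r \<in> long_words M" "p \<in> long_words M \<Longrightarrow> Prod r p \<in> long_words M"
  by (auto simp: long_words_iff split: option.splits)

lemma epigroup_theory_nilpotent: "epigroup_theory (nilpotent M)"
  unfolding nilpotent_def
proof (rule epigroup_theory_nil_theory)
  show "q \<in> long_words M" if "flat p = flat q" "p \<in> long_words M" for p q
    using that by (simp add: long_words_iff)
  show "\<exists>n. \<forall>u. power_word u n \<in> long_words M" using long_words_power by blast
  show "p \<in> long_words M" if "flat p = None" for p
    using that by (simp add: long_words_iff)
qed (simp_all add: long_words_substitute long_words_Prod)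

lemma long_words_zeros: "long_words M \<subseteq> zeros (nilpotent M)"
  unfolding zeros_def nilpotent_def nil_theory_def by (auto intro: long_words_Prod)

lemma zero_reduced_nilpotent: "zero_reduced_theory (nilpotent M)"
proof -
  have "nil (nilpotent M)"
    unfolding nil_def using long_words_zeros[of M] by (auto simp: long_words_def)
  moreover have "p \<in> zeros (nilpotent M) \<or> flat p = flat q" if "(p, q) \<in> nilpotent M" for p q
    using that long_words_zeros[of M] by (auto simp: nilpotent_def nil_theory_def)
  ultimately show ?thesis
    using epigroup_theory_nilpotent by (auto simp: zero_reduced_theory_def)
qed

lemma zero_reduced_theory_Inter:
  assumes "zero_reduced_theory \<theta>" "zero_reduced_theory \<eta>"
  shows "zero_reduced_theory (\<theta> \<inter> \<eta>)"
  using assms epigroup_theory_Inter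
  unfolding zero_reduced_theory_def nil_def zeros_Inter by blast

lemma flat_power_Letter: "flat (power_word (Letter i) n) = Some (replicate (Suc n) i)"
proof (induction n)
  case (Suc n)
  then show ?case by (simp add: replicate_append_same)
qed simp

text \<open>If all letters of a zero word take the value \<open>x (bar x)\<close>, so does the word, because this is
  an idempotent. Hence \<open>x (bar x) = 0\<close>, and \<open>bar x = x (bar x) (bar x) = 0\<close>.\<close>

lemma zeros_nonempty_imp_nil:
  assumes \<theta>: "epigroup_theory \<theta>" and w: "w \<in> zeros \<theta>"
  shows "nil \<theta>"
proof -
  note fi = epigroup_theory_fi[OF \<theta>]
  let ?e = "Prod (Letter 0) (Bar (Letter 0))"
  have "(substitute (\<lambda>_. ?e) w, ?e) \<in> \<theta>"
  proof (rule in_theoryI[OF fi])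
    fix S :: "uword unary_alg" and h :: "nat \<Rightarrow> uword"
    assume S: "S \<in> models \<theta>" and h: "range h \<subseteq> carrier S"
    interpret epigroup_laws S by (rule epigroup_laws_models[OF \<theta> S])
    define e where "e = word_val S h ?e"
    have "h 0 \<in> carrier S" using h by auto
    then have e: "e \<in> carrier S" "prd S e e = e"
      using idem_idempotent by (simp_all add: e_def closed bar_closed)
    have "word_val S (\<lambda>_. e) w = e"
      by (induction w) (use e idempotent_bar in auto)
    then show "word_val S h (substitute (\<lambda>_. ?e) w) = word_val S h ?e"
      by (simp add: word_val_substitute e_def)
  qed
  then have "?e \<in> zeros \<theta>" by (rule zeros_closed[OF fi zeros_substitute[OF fi w]])
  moreover have "(Prod ?e (Bar (Letter 0)), Bar (Letter 0)) \<in> \<theta>"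
  proof (rule in_theoryI[OF fi])
    fix S :: "uword unary_alg" and h :: "nat \<Rightarrow> uword"
    assume S: "S \<in> models \<theta>" and h: "range h \<subseteq> carrier S"
    interpret epigroup_laws S by (rule epigroup_laws_models[OF \<theta> S])
    have "h 0 \<in> carrier S" using h by auto
    then show "word_val S h (Prod ?e (Bar (Letter 0))) = word_val S h (Bar (Letter 0))"
      using idem_bar by simp
  qed
  ultimately show ?thesis
    unfolding nil_def using zeros_Prod(1)[OF fi] zeros_closed[OF fi] by blast
qed

text \<open>The class of all epigroups is not a variety, since an epigroup variety satisfies
  \<open>x^n x (bar x) = x^n\<close> for some \<open>n\<close> and so does not contain all nilpotent semigroups. Hence at
  least one word is zero in a 0-reduced variety, which is then nil.\<close>

lemma zero_reduced_variety_models_iff: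
  assumes inf: "infinite (UNIV :: 'a set)" and \<theta>: "epigroup_theory \<theta>"
  shows "zero_reduced_variety (models \<theta> :: 'a unary_alg set) \<longleftrightarrow> zero_reduced_theory \<theta>"
proof
  note fi = epigroup_theory_fi[OF \<theta>]
  assume zr: "zero_reduced_theory \<theta>"
  have "models \<theta> = {S :: 'a unary_alg. epigroup S \<and> (\<forall>w\<in>zeros \<theta>. satisfies S (eq_zero w))}"
  proof (intro equalityI subsetI)
    fix S :: "'a unary_alg" assume S: "S \<in> models \<theta>"
    have "eq_zero w \<subseteq> theory_of S" if "w \<in> zeros \<theta>" for w
      using S that eq_zero_subset_iff[OF fi] by (auto simp: models_iff)
    then show "S \<in> {S. epigroup S \<and> (\<forall>w\<in>zeros \<theta>. satisfies S (eq_zero w))}"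
      using epigroup_laws_models[OF \<theta> S] by (simp add: epigroup_iff_laws satisfies_iff)
  next
    fix S :: "'a unary_alg"
    assume "S \<in> {S. epigroup S \<and> (\<forall>w\<in>zeros \<theta>. satisfies S (eq_zero w))}"
    then have laws: "epigroup_laws S" and sat: "\<And>w. w \<in> zeros \<theta> \<Longrightarrow> eq_zero w \<subseteq> theory_of S"
      by (auto simp: epigroup_iff_laws satisfies_iff)
    have alg: "is_unary_alg S" by (rule epigroup_laws.is_unary_alg[OF laws])
    note fS = fully_invariant_theory_of[OF alg]
    have zeros: "w \<in> zeros (theory_of S)" if "w \<in> zeros \<theta>" for w
      using sat[OF that] eq_zero_subset_iff[OF fS] by blast
    have "(p, q) \<in> theory_of S" if pq: "(p, q) \<in> \<theta>" for p q
    proof (cases "p \<in> zeros \<theta>")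
      case True
      then show ?thesis
        using zeros_related[OF fS] zeros zeros_closed[OF fi True pq] by blast
    next
      case False
      then have "flat p = flat q" "flat p \<noteq> None"
        using zr pq nil_imp_zeros[OF fi] by (auto simp: zero_reduced_theory_def)
      moreover have "(Prod (Prod u v) w, Prod u (Prod v w)) \<in> theory_of S" for u v w
        using theory_of_epigroup_laws(1)[OF laws] unfolding theory_of_def by blast
      ultimately show ?thesis using related_if_flat_eq[OF fS] by blast
    qed
    then show "S \<in> models \<theta>" using alg by (auto simp: models_iff)
  qed
  then show "zero_reduced_variety (models \<theta> :: 'a unary_alg set)"
    using epigroup_variety_models_iff[OF inf fi] \<theta> unfolding zero_reduced_variety_def by blast
next
  note fi = epigroup_theory_fi[OF \<theta>]
  assume "zero_reduced_variety (models \<theta> :: 'a unary_alg set)"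
  then obtain W where
    W: "models \<theta> = {S :: 'a unary_alg. epigroup S \<and> (\<forall>w\<in>W. satisfies S (eq_zero w))}"
    by (auto simp: zero_reduced_variety_def)
  have W_theory: "\<theta> \<subseteq> \<eta>" if \<eta>: "epigroup_theory \<eta>" and "W \<subseteq> zeros \<eta>" for \<eta>
  proof -
    have "S \<in> models \<theta>" if S: "S \<in> models \<eta>" for S :: "'a unary_alg"
    proof -
      have "eq_zero w \<subseteq> theory_of S" if "w \<in> W" for w
        using S that \<open>W \<subseteq> zeros \<eta>\<close> eq_zero_subset_iff[OF epigroup_theory_fi[OF \<eta>]]
        by (auto simp: models_iff)
      then show ?thesis
        using epigroup_laws_models[OF \<eta> S] by (simp add: W epigroup_iff_laws satisfies_iff)
    qed
    then show ?thesis using models_mono_iff[OF inf epigroup_theory_fi[OF \<eta>]] by blast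
  qed
  have W_zeros: "W \<subseteq> zeros \<theta>"
  proof
    fix w assume "w \<in> W"
    then have "(models \<theta> :: 'a unary_alg set) \<subseteq> models (eq_zero w)"
      by (auto simp: W models_iff satisfies_iff epigroup_iff_laws epigroup_laws.is_unary_alg)
    then show "w \<in> zeros \<theta>"
      using models_mono_iff[OF inf fi] eq_zero_subset_iff[OF fi] by blast
  qed
  obtain n where n: "\<And>u. (Prod (power_word u n) (Prod u (Bar u)), power_word u n) \<in> \<theta>"
    using \<theta> unfolding epigroup_theory_def by blast
  have "W \<noteq> {}"
  proof
    assume "W = {}"
    then have "\<theta> \<subseteq> nilpotent (Suc n)" by (intro W_theory epigroup_theory_nilpotent) simp
    with n[of "Letter 0"] show False
      by (auto simp: nilpotent_def nil_theory_def long_words_iff flat_power_Letter)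
  qed
  then have nil: "nil \<theta>" using zeros_nonempty_imp_nil[OF \<theta>] W_zeros by blast
  have "zeros \<theta> \<subseteq> zeros (zero_hull \<theta>)"
    unfolding zeros_def[of "zero_hull \<theta>"] using zeros_Prod[OF fi] by (auto simp: nil_theory_def)
  then have "\<theta> \<subseteq> zero_hull \<theta>"
    using W_theory[OF epigroup_theory_zero_hull[OF \<theta> nil]] W_zeros by blast
  then show "zero_reduced_theory \<theta>"
    using \<theta> nil by (fastforce simp: zero_reduced_theory_def nil_theory_def)
qed

section \<open>Special elements of the lattice\<close>

text \<open>The two conditions refer to the theories, so the order and the operations of the lattice of
  varieties are reversed.\<close>

definition lower_modular_theory :: "identity set \<Rightarrow> bool" where
  "lower_modular_theory \<theta> \<longleftrightarrow>
     (\<forall>\<eta> \<zeta>. epigroup_theory \<eta> \<longrightarrow> epigroup_theory \<zeta> \<longrightarrow> \<eta> \<subseteq> \<theta> \<longrightarrow>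
        \<theta> \<inter> (\<eta> \<union> \<zeta>)\<^sup>* = (\<eta> \<union> \<theta> \<inter> \<zeta>)\<^sup>*)"

definition modular_theory :: "identity set \<Rightarrow> bool" where
  "modular_theory \<theta> \<longleftrightarrow>
     (\<forall>\<eta> \<zeta>. epigroup_theory \<eta> \<longrightarrow> epigroup_theory \<zeta> \<longrightarrow> \<zeta> \<subseteq> \<eta> \<longrightarrow>
        (\<theta> \<union> \<zeta>)\<^sup>* \<inter> \<eta> = (\<theta> \<inter> \<eta> \<union> \<zeta>)\<^sup>*)"

text \<open>The variety has a least nontrivial subvariety, with theory \<open>\<alpha>\<close>, and is not equal to it.\<close>

definition monolithic_nonatom_theory :: "identity set \<Rightarrow> bool" where
  "monolithic_nonatom_theory \<theta> \<longleftrightarrow>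
     (\<exists>\<alpha>. epigroup_theory \<alpha> \<and> \<theta> \<subset> \<alpha> \<and> \<alpha> \<noteq> UNIV \<and>
        (\<forall>\<zeta>. epigroup_theory \<zeta> \<longrightarrow> \<theta> \<subseteq> \<zeta> \<longrightarrow> \<zeta> = UNIV \<or> \<zeta> \<subseteq> \<alpha>))"

lemma rtrancl_subset_fi:
  assumes "fully_invariant \<rho>" "\<sigma> \<subseteq> \<rho>"
  shows "\<sigma>\<^sup>* \<subseteq> \<rho>"
proof clarify
  fix p q assume "(p, q) \<in> \<sigma>\<^sup>*"
  then show "(p, q) \<in> \<rho>"
    using assms by induction (auto intro: fi_refl fi_trans)
qed

context
  fixes \<theta> assumes zr: "zero_reduced_theory \<theta>"
begin

lemma zr_theory: "epigroup_theory \<theta>" and zr_nil: "nil \<theta>"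
  using zr by (simp_all add: zero_reduced_theory_def)

lemma zr_step:
  assumes "(r, r') \<in> \<theta>" "r \<notin> zeros \<theta>" "epigroup_theory \<eta>"
  shows "(r, r') \<in> \<eta>"
proof -
  have "flat r \<noteq> None" using assms(2) nil_imp_zeros epigroup_theory_fi zr_theory zr_nil by blast
  moreover have "flat r = flat r'" using assms(1,2) zr by (auto simp: zero_reduced_theory_def)
  ultimately show ?thesis using in_theory_if_flat_eq[OF assms(3)] by blast
qed

text \<open>Outside its zeros, a 0-reduced theory \<open>\<theta>\<close> is contained in every other theory. Consider a
  chain of \<open>\<eta>\<close>-steps and \<open>\<zeta>\<close>-steps between two zeros of \<open>\<theta>\<close>. An excursion out of the zeros
  can begin and end with \<open>\<zeta>\<close>-steps only, because \<open>\<eta> \<subseteq> \<theta>\<close>, and in between all steps are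
  \<open>\<zeta>\<close>-steps. So the excursion is a single pair of \<open>\<theta> \<inter> \<zeta>\<close>.\<close>

lemma zero_reduced_imp_lower_modular: "lower_modular_theory \<theta>"
  unfolding lower_modular_theory_def
proof (intro allI impI equalityI)
  fix \<eta> \<zeta> assume \<eta>: "epigroup_theory \<eta>" and \<zeta>: "epigroup_theory \<zeta>" and sub: "\<eta> \<subseteq> \<theta>"
  note fi = epigroup_theory_fi[OF zr_theory] and fi\<zeta> = epigroup_theory_fi[OF \<zeta>]
  have "(\<eta> \<union> \<theta> \<inter> \<zeta>)\<^sup>* \<subseteq> \<theta>" by (rule rtrancl_subset_fi[OF fi]) (use sub in auto)
  moreover have "(\<eta> \<union> \<theta> \<inter> \<zeta>)\<^sup>* \<subseteq> (\<eta> \<union> \<zeta>)\<^sup>*" by (rule rtrancl_mono) auto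
  ultimately show "(\<eta> \<union> \<theta> \<inter> \<zeta>)\<^sup>* \<subseteq> \<theta> \<inter> (\<eta> \<union> \<zeta>)\<^sup>*" by auto
  show "\<theta> \<inter> (\<eta> \<union> \<zeta>)\<^sup>* \<subseteq> (\<eta> \<union> \<theta> \<inter> \<zeta>)\<^sup>*"
  proof clarify
    fix p q assume pq: "(p, q) \<in> \<theta>" "(p, q) \<in> (\<eta> \<union> \<zeta>)\<^sup>*"
    show "(p, q) \<in> (\<eta> \<union> \<theta> \<inter> \<zeta>)\<^sup>*"
    proof (cases "p \<in> zeros \<theta>")
      case False
      then have "(p, q) \<in> \<eta>" using zr_step[OF pq(1) _ \<eta>] by blast
      then show ?thesis by auto
    next
      case p: True
      have "\<exists>i\<in>zeros \<theta>. (p, i) \<in> (\<eta> \<union> \<theta> \<inter> \<zeta>)\<^sup>* \<and> (i, q) \<in> \<zeta>" using pq(2)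
      proof induction
        case base
        then show ?case using p fi_refl[OF fi\<zeta>] by blast
      next
        case (step r r')
        then obtain i where i: "i \<in> zeros \<theta>" "(p, i) \<in> (\<eta> \<union> \<theta> \<inter> \<zeta>)\<^sup>*" "(i, r) \<in> \<zeta>" by blast
        show ?case
        proof (cases "(r, r') \<in> \<zeta>")
          case True
          then show ?thesis using i fi_trans[OF fi\<zeta>] by blast
        next
          case False
          then have r: "(r, r') \<in> \<eta>" using step by blast
          then have "r \<in> zeros \<theta>" using False zr_step[OF _ _ \<zeta>] sub by blast
          moreover have "(r, r') \<in> \<theta>" using r sub by blast
          ultimately have "(i, r) \<in> \<theta> \<inter> \<zeta>" "r' \<in> zeros \<theta>"
            using i(1,3) zeros_related[OF fi] zeros_closed[OF fi] by blast+
          moreover from this r i(2) have "(p, r') \<in> (\<eta> \<union> \<theta> \<inter> \<zeta>)\<^sup>*"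
            by (meson Un_iff rtrancl.rtrancl_into_rtrancl)
          ultimately show ?thesis using fi_refl[OF fi\<zeta>] by blast
        qed
      qed
      then obtain i where i: "i \<in> zeros \<theta>" "(p, i) \<in> (\<eta> \<union> \<theta> \<inter> \<zeta>)\<^sup>*" "(i, q) \<in> \<zeta>" by blast
      then have "(i, q) \<in> \<theta> \<inter> \<zeta>"
        using zeros_related[OF fi] zeros_closed[OF fi p pq(1)] by blast
      with i(2) show ?thesis by (meson Un_iff rtrancl.rtrancl_into_rtrancl)
    qed
  qed
qed

text \<open>A chain of \<open>\<theta>\<close>-steps and \<open>\<zeta>\<close>-steps either avoids nontrivial \<open>\<theta>\<close>-steps or passes
  through zeros. In the latter case all steps before the first zero and all steps after the last
  one are in \<open>\<zeta>\<close>, so these two zeros are \<open>\<eta>\<close>-related if the ends of the chain are.\<close>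

lemma zero_reduced_imp_modular: "modular_theory \<theta>"
  unfolding modular_theory_def
proof (intro allI impI equalityI)
  fix \<eta> \<zeta> assume \<eta>: "epigroup_theory \<eta>" and \<zeta>: "epigroup_theory \<zeta>" and sub: "\<zeta> \<subseteq> \<eta>"
  note fi = epigroup_theory_fi[OF zr_theory]
  note fi\<zeta> = epigroup_theory_fi[OF \<zeta>] and fi\<eta> = epigroup_theory_fi[OF \<eta>]
  have "(\<theta> \<inter> \<eta> \<union> \<zeta>)\<^sup>* \<subseteq> \<eta>" by (rule rtrancl_subset_fi[OF fi\<eta>]) (use sub in auto)
  moreover have "(\<theta> \<inter> \<eta> \<union> \<zeta>)\<^sup>* \<subseteq> (\<theta> \<union> \<zeta>)\<^sup>*" by (rule rtrancl_mono) auto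
  ultimately show "(\<theta> \<inter> \<eta> \<union> \<zeta>)\<^sup>* \<subseteq> (\<theta> \<union> \<zeta>)\<^sup>* \<inter> \<eta>" by auto
  show "(\<theta> \<union> \<zeta>)\<^sup>* \<inter> \<eta> \<subseteq> (\<theta> \<inter> \<eta> \<union> \<zeta>)\<^sup>*"
  proof clarify
    fix p q assume pq: "(p, q) \<in> (\<theta> \<union> \<zeta>)\<^sup>*" "(p, q) \<in> \<eta>"
    have "(p, q) \<in> \<zeta> \<or> (\<exists>i\<in>zeros \<theta>. \<exists>j\<in>zeros \<theta>. (p, i) \<in> \<zeta> \<and> (j, q) \<in> \<zeta>)" using pq(1)
    proof induction
      case base
      then show ?case using fi_refl[OF fi\<zeta>] by blast
    next
      case (step r r')
      show ?case
      proof (cases "(r, r') \<in> \<zeta>")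
        case True
        then show ?thesis using step.IH fi_trans[OF fi\<zeta>] by blast
      next
        case False
        then have r: "(r, r') \<in> \<theta>" using step by blast
        then have "r \<in> zeros \<theta>" using False zr_step[OF _ _ \<zeta>] by blast
        moreover from this r have "r' \<in> zeros \<theta>" by (rule zeros_closed[OF fi])
        ultimately show ?thesis using step.IH fi_refl[OF fi\<zeta>] by blast
      qed
    qed
    then show "(p, q) \<in> (\<theta> \<inter> \<eta> \<union> \<zeta>)\<^sup>*"
    proof (elim disjE bexE conjE)
      fix i j assume ij: "i \<in> zeros \<theta>" "j \<in> zeros \<theta>" "(p, i) \<in> \<zeta>" "(j, q) \<in> \<zeta>"
      have "(i, j) \<in> \<eta>"
        using ij(3,4) pq(2) sub fi_trans[OF fi\<eta>] fi_sym[OF fi\<eta>] by blast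
      then have "(i, j) \<in> \<theta> \<inter> \<eta>" using ij(1,2) zeros_related[OF fi] by blast
      with ij(3,4) show ?thesis
        by (meson Un_iff r_into_rtrancl rtrancl.rtrancl_into_rtrancl)
    qed auto
  qed
qed

end

section \<open>Semilattices and null semigroups\<close>

definition semilattice_theory :: "identity set" where
  "semilattice_theory = {(p, q). letters p = letters q}"

definition null_theory :: "identity set" where
  "null_theory = {(p, q). p = q \<or> p \<notin> range Letter \<and> q \<notin> range Letter}"

lemma epigroup_theory_semilattice: "epigroup_theory semilattice_theory"
proof -
  have "fully_invariant semilattice_theory"
    by (rule fully_invariantI) (auto simp: semilattice_theory_def letters_substitute)
  moreover have "letters (power_word u n) = letters u" for u n by (induction n) auto
  ultimately show ?thesis
    unfolding epigroup_theory_def by (auto simp: semilattice_theory_def)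
qed

lemma substitute_not_Letter: "p \<notin> range Letter \<Longrightarrow> substitute \<sigma> p \<notin> range Letter"
  by (cases p) auto

lemma epigroup_theory_null: "epigroup_theory null_theory"
proof -
  have "fully_invariant null_theory"
    by (rule fully_invariantI) (auto simp: null_theory_def dest: substitute_not_Letter)
  moreover have "power_word u 1 \<notin> range Letter" for u by auto
  ultimately show ?thesis
    unfolding epigroup_theory_def by (auto simp: null_theory_def intro!: exI[of _ 1])
qed

lemma null_theory_neq_UNIV: "null_theory \<noteq> UNIV"
proof -
  have "(Letter 0, Letter 1) \<notin> null_theory" by (auto simp: null_theory_def)
  then show ?thesis by blast
qed

text \<open>In a term with the single letter \<open>x\<close>, the letter \<open>x\<close> can be moved to the front even if the
  term begins with \<open>Bar\<close>, since \<open>bar a = a (bar a) (bar a)\<close>.\<close>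

lemma (in epigroup_laws) one_letter_word:
  assumes x: "x \<in> carrier S"
  shows "w \<in> range Letter \<or> (\<exists>w'. word_val S (\<lambda>_. x) w = prd S x (word_val S (\<lambda>_. x) w'))"
proof (induction w)
  case (Prod u v)
  have val: "word_val S (\<lambda>_. x) u \<in> carrier S" for u
    by (rule word_val_in_carrier[OF is_unary_alg]) (use x in auto)
  from Prod(1) show ?case
  proof (elim disjE exE)
    assume "u \<in> range Letter"
    then show ?thesis by auto
  next
    fix u' assume "word_val S (\<lambda>_. x) u = x \<cdot> word_val S (\<lambda>_. x) u'"
    then have "word_val S (\<lambda>_. x) (Prod u v) = x \<cdot> word_val S (\<lambda>_. x) (Prod u' v)"
      using x val by (simp add: assoc)
    then show ?thesis by blast
  qed
next
  case (Bar u)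
  have val: "word_val S (\<lambda>_. x) u \<in> carrier S" for u
    by (rule word_val_in_carrier[OF is_unary_alg]) (use x in auto)
  have bar: "word_val S (\<lambda>_. x) (Bar u)
      = word_val S (\<lambda>_. x) u \<cdot> word_val S (\<lambda>_. x) (Prod (Bar u) (Bar u))"
    using idem_bar[OF val] val by (simp add: assoc bar_closed)
  from Bar show ?case
  proof (elim disjE exE)
    assume "u \<in> range Letter"
    then have "word_val S (\<lambda>_. x) u = x" by auto
    with bar show ?thesis by metis
  next
    fix u' assume "word_val S (\<lambda>_. x) u = x \<cdot> word_val S (\<lambda>_. x) u'"
    then have "word_val S (\<lambda>_. x) (Bar u) = x \<cdot> word_val S (\<lambda>_. x) (Prod u' (Prod (Bar u) (Bar u)))"
      using bar x val by (simp add: assoc closed bar_closed)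
    then show ?thesis by blast
  qed
qed auto

text \<open>A nontrivial variety that does not contain the null semigroups satisfies \<open>x = q\<close>, where
  \<open>q\<close> is not a letter. With all letters of \<open>q\<close> replaced by \<open>x\<close>, one gets \<open>x = x w = x x t\<close>,
  and iterating this shows that every power of \<open>x\<close> divides \<open>x\<close> on the left.\<close>

lemma not_below_null_theory:
  assumes \<theta>: "epigroup_theory \<theta>" and null: "\<not> \<theta> \<subseteq> null_theory"
    and S: "S \<in> models \<theta>" and x: "x \<in> carrier S"
  shows "\<theta> = UNIV \<or> (\<exists>s\<in>carrier S. x = prd S (pow_Suc S x j) s)"
proof -
  note fi = epigroup_theory_fi[OF \<theta>]
  interpret epigroup_laws S by (rule epigroup_laws_models[OF \<theta> S])
  obtain p q where "(p, q) \<in> \<theta>" "p \<noteq> q" "p \<in> range Letter \<or> q \<in> range Letter"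
    using null by (auto simp: null_theory_def)
  then obtain i q where iq: "(Letter i, q) \<in> \<theta>" "q \<noteq> Letter i"
    using fi_sym[OF fi] by (metis rangeE)
  show ?thesis
  proof (cases "q \<in> range Letter")
    case True
    then show ?thesis using iq theory_UNIV_I[OF fi] by auto
  next
    case False
    have val: "word_val S (\<lambda>_. x) u \<in> carrier S" for u
      by (rule word_val_in_carrier[OF is_unary_alg]) (use x in auto)
    have "range (\<lambda>_ :: nat. x) \<subseteq> carrier S" using x by auto
    from modelsD[OF S iq(1) this] have "x = word_val S (\<lambda>_. x) q" by simp
    then obtain w where w: "x = prd S x (word_val S (\<lambda>_. x) w)"
      using one_letter_word[OF x, of q] False by auto
    have "\<exists>t\<in>carrier S. x = prd S (prd S x x) t"
    proof (cases "w \<in> range Letter")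
      case True
      then have "x = prd S x x" using w by auto
      then show ?thesis using x by (metis (no_types))
    next
      case False
      then obtain w' where "word_val S (\<lambda>_. x) w = prd S x (word_val S (\<lambda>_. x) w')"
        using one_letter_word[OF x, of w] by auto
      then have "x = prd S (prd S x x) (word_val S (\<lambda>_. x) w')"
        using w x val by (simp add: assoc)
      then show ?thesis using val by blast
    qed
    then obtain t where t: "t \<in> carrier S" "x = prd S (prd S x x) t" by blast
    have step: "pow_Suc S x j = prd S (pow_Suc S x (Suc j)) t" for j
    proof (cases j)
      case 0
      then show ?thesis using t by simp
    next
      case (Suc k)
      have "pow_Suc S x (Suc k) = prd S (pow_Suc S x k) (prd S (prd S x x) t)"
        using arg_cong[OF t(2), of "prd S (pow_Suc S x k)"] by simp
      also have "\<dots> = prd S (pow_Suc S x (Suc (Suc k))) t"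
        using x t(1) by (simp add: assoc closed)
      finally show ?thesis using Suc by simp
    qed
    have "\<exists>s\<in>carrier S. x = prd S (pow_Suc S x j) s"
    proof (induction j)
      case 0
      show ?case using w val by auto
    next
      case (Suc j)
      then obtain s where s: "s \<in> carrier S" "x = prd S (pow_Suc S x j) s" by blast
      then have "x = prd S (pow_Suc S x (Suc j)) (prd S t s)"
        using step[of j] x t(1) by (metis assoc pow_closed)
      then show ?case using s(1) t(1) closed by blast
    qed
    then show ?thesis by blast
  qed
qed

text \<open>In a nil variety, such a division would make \<open>x\<close> zero.\<close>

lemma nil_theory_below_null:
  assumes \<theta>: "epigroup_theory \<theta>" and nil: "nil \<theta>"
  shows "\<theta> = UNIV \<or> \<theta> \<subseteq> null_theory"
proof (rule ccontr)
  assume not: "\<not> (\<theta> = UNIV \<or> \<theta> \<subseteq> null_theory)"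
  note fi = epigroup_theory_fi[OF \<theta>]
  obtain n where n: "\<And>u. power_word u n \<in> zeros \<theta>" using nil_imp_power_zero[OF \<theta> nil] by blast
  have "(Letter 0, Letter 1) \<in> \<theta>"
  proof (rule in_theoryI[OF fi])
    fix S :: "uword unary_alg" and h :: "nat \<Rightarrow> uword"
    assume S: "S \<in> models \<theta>" and h: "range h \<subseteq> carrier S"
    have zero: "x = pow_Suc S x n" if x: "x \<in> carrier S" for x
    proof -
      obtain s where s: "s \<in> carrier S" "x = prd S (pow_Suc S x n) s"
        using not_below_null_theory[OF \<theta> _ S x] not by blast
      have "(Prod (power_word (Letter 0) n) (Letter 1), power_word (Letter 0) n) \<in> \<theta>"
        using n by (auto simp: zeros_def)
      from modelsD[OF S this, of "\<lambda>i. if i = 0 then x else s"] x s show ?thesis by auto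
    qed
    have "(power_word (Letter 0) n, power_word (Letter 1) n) \<in> \<theta>"
      using n zeros_related[OF fi] by blast
    from modelsD[OF S this h] have "pow_Suc S (h 0) n = pow_Suc S (h 1) n" by simp
    moreover have "h 0 \<in> carrier S" "h 1 \<in> carrier S" using h by auto
    ultimately show "word_val S h (Letter 0) = word_val S h (Letter 1)" using zero by simp
  qed
  then show False using theory_UNIV_I[OF fi, of 0 1] not by simp
qed

text \<open>Every nil variety that properly contains the null semigroups has them as its least
  nontrivial subvariety. The join with the semigroups in which \<open>xyz = 0\<close> ensures that the
  inclusion is proper.\<close>

lemma monolithic_nilpotent_Inter:
  assumes "zero_reduced_theory \<theta>"
  shows "monolithic_nonatom_theory (\<theta> \<inter> nilpotent 2)"
  unfolding monolithic_nonatom_theory_def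
proof (intro exI[of _ null_theory] conjI allI impI)
  have zr: "zero_reduced_theory (\<theta> \<inter> nilpotent 2)"
    using assms zero_reduced_nilpotent zero_reduced_theory_Inter by blast
  show "null_theory \<noteq> UNIV" by (rule null_theory_neq_UNIV)
  show "epigroup_theory null_theory" by (rule epigroup_theory_null)
  show "\<zeta> = UNIV \<or> \<zeta> \<subseteq> null_theory"
    if "epigroup_theory \<zeta>" "\<theta> \<inter> nilpotent 2 \<subseteq> \<zeta>" for \<zeta>
    using that zr zeros_mono nil_theory_below_null
    unfolding zero_reduced_theory_def nil_def by blast
  have xy: "(Prod (Letter 0) (Letter 1), Prod (Letter 1) (Letter 0)) \<notin> nilpotent 2"
    by (simp add: nilpotent_def nil_theory_def long_words_iff)
  then have "nilpotent 2 \<noteq> UNIV" by blast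
  then have "nilpotent 2 \<subseteq> null_theory"
    using nil_theory_below_null zero_reduced_nilpotent by (auto simp: zero_reduced_theory_def)
  moreover have "(Prod (Letter 0) (Letter 1), Prod (Letter 1) (Letter 0)) \<in> null_theory"
    by (auto simp: null_theory_def)
  ultimately show "\<theta> \<inter> nilpotent 2 \<subset> null_theory" using xy by blast
qed

section \<open>Lower-modular nil varieties are 0-reduced\<close>

text \<open>The maps \<open>x \<mapsto> ax + b\<close> with \<open>a \<noteq> 0\<close>, under composition.\<close>

definition affine_group :: "(rat \<times> rat) unary_alg" where
  "affine_group =
     \<lparr>carrier = {(a, b). a \<noteq> 0},
      prd = (\<lambda>(a, b) (c, d). (a * c, b + a * d)),
      bar = (\<lambda>(a, b). (1 / a, - b / a))\<rparr>"

lemma affine_group: "is_unary_alg affine_group" "epigroup_laws affine_group"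
  and affine_group_unit: "x \<in> carrier affine_group \<Longrightarrow>
    prd affine_group x (prd affine_group x (bar affine_group x)) = x"
proof -
  show unit: "prd affine_group x (prd affine_group x (bar affine_group x)) = x"
    if "x \<in> carrier affine_group" for x
    using that by (auto simp: affine_group_def)
  show alg: "is_unary_alg affine_group"
    by (auto simp: is_unary_alg_def affine_group_def intro: exI[of _ 1])
  show "epigroup_laws affine_group"
  proof
    fix x assume "x \<in> carrier affine_group"
    from unit[OF this]
    have "prd affine_group (pow_Suc affine_group x 0) (prd affine_group x (bar affine_group x))
        = pow_Suc affine_group x 0" by simp
    then show "\<exists>n. prd affine_group (pow_Suc affine_group x n)
        (prd affine_group x (bar affine_group x)) = pow_Suc affine_group x n" by blast
  qed (auto simp: affine_group_def field_simps intro: exI[of _ 1])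
qed

lemma epigroup_theory_affine_group: "epigroup_theory (theory_of affine_group)"
proof -
  have "word_val affine_group h u \<in> carrier affine_group"
    if "range h \<subseteq> carrier affine_group" for h u
    by (rule word_val_in_carrier[OF affine_group(1) that])
  then have "\<forall>u. (Prod (power_word u 0) (Prod u (Bar u)), power_word u 0) \<in> theory_of affine_group"
    by (auto simp: theory_of_def affine_group_unit)
  moreover have "(Prod (Prod u v) w, Prod u (Prod v w)) \<in> theory_of affine_group" for u v w
    using theory_of_epigroup_laws(1)[OF affine_group(2)]
    by (simp add: theory_of_def del: word_val.simps)
  moreover have "(Prod (Bar u) u, Prod u (Bar u)) \<in> theory_of affine_group" for u
    using theory_of_epigroup_laws(2)[OF affine_group(2)]
    by (simp add: theory_of_def del: word_val.simps)
  moreover have "(Prod (Prod (Bar u) u) (Bar u), Bar u) \<in> theory_of affine_group" for u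
    using theory_of_epigroup_laws(3)[OF affine_group(2)]
    by (simp add: theory_of_def del: word_val.simps)
  ultimately show ?thesis
    unfolding epigroup_theory_def using fully_invariant_theory_of[OF affine_group(1)] by blast
qed

lemma horner_sum_digits_inject:
  fixes B :: nat
  assumes "length v = length w" "\<forall>i\<in>set v \<union> set w. i < B" "horner_sum (\<lambda>a. a) B v = horner_sum (\<lambda>a. a) B w"
  shows "v = w"
  using assms
proof (induction v w rule: list_induct2)
  case (Cons i v j w)
  then have eq: "i + B * horner_sum (\<lambda>a. a) B v = j + B * horner_sum (\<lambda>a. a) B w" and ij: "i < B" "j < B" by auto
  have "i = (i + B * horner_sum (\<lambda>a. a) B v) mod B" using ij by simp
  also have "\<dots> = j" unfolding eq using ij by simp
  finally have "i = j" .
  then show ?case using eq ij Cons by auto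
qed simp

text \<open>If the letters are interpreted by the maps \<open>x \<mapsto> Bx + i\<close>, where \<open>B\<close> exceeds all letters
  involved, then the value of a word contains the number whose digits in base \<open>B\<close> are the letters
  of the word.\<close>

lemma affine_group_separates:
  assumes pq: "(p, q) \<in> theory_of affine_group" and v: "flat p = Some v" and w: "flat q = Some w"
  shows "v = w"
proof -
  \<comment> \<open>\<open>B\<close> exceeds all letters, and \<open>B > 1\<close> makes \<open>B^n\<close> determine \<open>n\<close>.\<close>
  define B where "B = sum_list v + sum_list w + 2"
  have B: "\<forall>i\<in>set v \<union> set w. i < B" "2 \<le> B"
    using member_le_sum_list[of _ v] member_le_sum_list[of _ w] by (fastforce simp: B_def)+
  let ?h = "\<lambda>i :: nat. (rat_of_nat B, rat_of_nat i)"
  have val: "word_val affine_group ?h p = (of_nat (B ^ length v), of_nat (horner_sum (\<lambda>a. a) B v))"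
    if "flat p = Some v" for p v
    using that
  proof (induction p arbitrary: v)
    case (Prod p1 p2)
    then obtain v1 v2 where "flat p1 = Some v1" "flat p2 = Some v2" "v = v1 @ v2"
      by (auto split: option.splits)
    with Prod show ?case
      by (simp add: affine_group_def power_add horner_sum_append)
  qed auto
  have "range ?h \<subseteq> carrier affine_group" using B by (auto simp: affine_group_def)
  from theory_ofD[OF pq this]
  have "rat_of_nat (B ^ length v) = rat_of_nat (B ^ length w)"
    and "rat_of_nat (horner_sum (\<lambda>a. a) B v) = rat_of_nat (horner_sum (\<lambda>a. a) B w)"
    by (simp_all only: val[OF v] val[OF w] prod.inject)
  then have "length v = length w" "horner_sum (\<lambda>a. a) B v = horner_sum (\<lambda>a. a) B w"
    using B by (simp_all only: of_nat_eq_iff power_inject_exp)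
  then show ?thesis using horner_sum_digits_inject B by blast
qed

text \<open>In a group \<open>p = p (bar x) x\<close>, and the right hand side is zero in a nil variety. So modulo
  the zeros of the nil theory \<open>\<theta>\<close> and the identities of the affine group, any two words are equal.
  If \<open>\<theta>\<close> is lower-modular, then nonzero \<open>\<theta>\<close>-related words are related by the identities of this
  group, which separates any two words.\<close>

lemma nil_lower_modular_imp_zero_reduced:
  assumes \<theta>: "epigroup_theory \<theta>" and nil: "nil \<theta>" and lm: "lower_modular_theory \<theta>"
  shows "zero_reduced_theory \<theta>"
proof -
  note fi = epigroup_theory_fi[OF \<theta>]
  define \<zeta> where "\<zeta> = theory_of affine_group"
  have \<zeta>: "epigroup_theory \<zeta>" unfolding \<zeta>_def by (rule epigroup_theory_affine_group)
  note fi\<zeta> = epigroup_theory_fi[OF \<zeta>]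
  let ?R = "(zero_hull \<theta> \<union> \<theta> \<inter> \<zeta>)\<^sup>*"
  have "flat p = flat q" if pq: "(p, q) \<in> \<theta>" and p: "p \<notin> zeros \<theta>" for p q
  proof -
    let ?unit = "Prod (Bar (Letter 0)) (Letter 0)"
    have unit: "(r, Prod r ?unit) \<in> \<zeta>" for r
    proof -
      have "word_val affine_group h r = word_val affine_group h (Prod r ?unit)"
        if h: "range h \<subseteq> carrier affine_group" for h
      proof -
        have "prd affine_group x (prd affine_group (bar affine_group y) y) = x"
          if "y \<in> carrier affine_group" for x y
          using that by (cases x) (auto simp: affine_group_def)
        moreover have "h 0 \<in> carrier affine_group" using h by auto
        ultimately show ?thesis by simp
      qed
      then show ?thesis unfolding \<zeta>_def theory_of_def by blast
    qed
    have "Prod r ?unit \<in> zeros \<theta>" for r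
      by (rule nil_imp_zeros[OF fi nil]) (simp split: option.split)
    then have "(Prod p ?unit, Prod q ?unit) \<in> zero_hull \<theta>" by (simp add: nil_theory_def)
    then have "(p, q) \<in> (zero_hull \<theta> \<union> \<zeta>)\<^sup>*"
      using unit fi_sym[OF fi\<zeta> unit] by (meson Un_iff r_into_rtrancl rtrancl.rtrancl_into_rtrancl)
    then have "(p, q) \<in> ?R"
      using lm[unfolded lower_modular_theory_def, rule_format,
        OF epigroup_theory_zero_hull[OF \<theta> nil] \<zeta> zero_hull_subset[OF \<theta> nil]] pq by blast
    then have "q \<notin> zeros \<theta> \<and> (p, q) \<in> \<zeta>"
    proof induction
      case base
      then show ?case using p fi_refl[OF fi\<zeta>] by blast
    next
      case (step r r')
      then have "(r, r') \<in> \<theta>" using zero_hull_subset[OF \<theta> nil] by blast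
      then have "r' \<notin> zeros \<theta>"
        using step.IH zeros_closed[OF fi] fi_sym[OF fi] by blast
      moreover have "(r, r') \<in> \<zeta>"
      proof (cases "(r, r') \<in> \<zeta>")
        case False
        then have "flat r = flat r'" using step by (auto simp: nil_theory_def)
        moreover have "flat r \<noteq> None" using step.IH nil_imp_zeros[OF fi nil] by blast
        ultimately show ?thesis using in_theory_if_flat_eq[OF \<zeta>] by blast
      qed
      ultimately show ?case using step.IH fi_trans[OF fi\<zeta>] by blast
    qed
    moreover obtain v where "flat p = Some v" using p nil_imp_zeros[OF fi nil] by blast
    moreover obtain w where "flat q = Some w"
      using calculation nil_imp_zeros[OF fi nil] by blast
    ultimately show ?thesis using affine_group_separates \<zeta>_def by metis
  qed
  then show ?thesis using \<theta> nil by (auto simp: zero_reduced_theory_def)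
qed

section \<open>An identity of modular varieties\<close>

text \<open>The identity is \<open>x^(k+1) y^(k+1) = y^(2k+1) x^2\<close>. Its right hand side is longer by one,
  begins with \<open>y\<close> and ends with \<open>x\<close>, so that it implies \<open>x^(2k+2) = x^(2k+3)\<close> and
  \<open>ef = fe\<close> for idempotents. Large powers occur on both sides, so both are equal to words with
  \<open>Bar\<close> in a given variety.\<close>

definition list_power :: "nat \<Rightarrow> nat list \<Rightarrow> nat list" where
  "list_power n s = concat (replicate n s)"

definition left_word :: "nat \<Rightarrow> nat list \<Rightarrow> nat list \<Rightarrow> nat list" where
  "left_word k s t = list_power (k + 1) s @ list_power (k + 1) t"

definition right_word :: "nat \<Rightarrow> nat list \<Rightarrow> nat list \<Rightarrow> nat list" where
  "right_word k s t = list_power (2 * k + 1) t @ s @ s"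

text \<open>A proper instance of one of the two words is any word with a factor that is obtained from it
  by a substitution, except for the result of an injective renaming of its letters.\<close>

definition proper_instance :: "nat \<Rightarrow> nat list \<Rightarrow> bool" where
  "proper_instance k w \<longleftrightarrow>
     (\<exists>x y s t. s \<noteq> [] \<and> t \<noteq> [] \<and>
        (w = x @ left_word k s t @ y \<or> w = x @ right_word k s t @ y) \<and>
        \<not> (x = [] \<and> y = [] \<and> length s = 1 \<and> length t = 1 \<and> s \<noteq> t))"

lemma length_list_power [simp]: "length (list_power n s) = n * length s"
  by (induction n) (auto simp: list_power_def)

lemma list_power_singleton [simp]: "list_power n [a] = replicate n a"
  by (induction n) (auto simp: list_power_def)

lemma length_filter_list_power:
  "length (filter P (list_power n s)) = n * length (filter P s)"
  by (induction n) (auto simp: list_power_def)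

lemma set_list_power: "set (list_power n s) = (if n = 0 then {} else set s)"
  by (induction n) (auto simp: list_power_def)

lemma concat_map_list_power:
  "concat (map f (list_power n s)) = list_power n (concat (map f s))"
  by (induction n) (auto simp: list_power_def)

lemma left_right_word_length:
  "length (left_word k [a] [b]) = 2 * k + 2" "length (right_word k [a] [b]) = 2 * k + 3"
  by (auto simp: left_word_def right_word_def)

lemma left_word_inject:
  assumes "left_word k [a] [b] = left_word k [c] [d]"
  shows "a = c \<and> b = d"
  using arg_cong[OF assms, of hd] arg_cong[OF assms, of last] by (cases "k = 0") (simp_all add: left_word_def)

lemma right_word_inject:
  assumes "right_word k [a] [b] = right_word k [c] [d]"
  shows "a = c \<and> b = d"
  using arg_cong[OF assms, of hd] arg_cong[OF assms, of last] by (simp add: right_word_def)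

lemma not_proper_left:
  assumes ab: "a \<noteq> b" and k: "2 \<le> k"
  shows "\<not> proper_instance k (left_word k [a] [b])"
proof
  assume "proper_instance k (left_word k [a] [b])"
  then obtain x y s t where st: "s \<noteq> []" "t \<noteq> []"
    and eq: "left_word k [a] [b] = x @ left_word k s t @ y \<or> left_word k [a] [b] = x @ right_word k s t @ y"
    and proper: "\<not> (x = [] \<and> y = [] \<and> length s = 1 \<and> length t = 1 \<and> s \<noteq> t)"
    unfolding proper_instance_def by blast
  have pos: "1 \<le> length s" "1 \<le> length t" using st by (cases s; cases t; simp)+
  from eq show False
  proof
    assume eq: "left_word k [a] [b] = x @ left_word k s t @ y"
    from arg_cong[OF this, of length]
    have len: "2 * (k + 1) = length x + length y + (k + 1) * (length s + length t)"
      by (simp add: left_word_def algebra_simps)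
    have "\<not> 3 \<le> length s + length t"
    proof
      assume "3 \<le> length s + length t"
      then have "(k + 1) * 3 \<le> (k + 1) * (length s + length t)" by (rule mult_le_mono2)
      then show False using len by simp
    qed
    then have l: "length s = 1" "length t = 1" using pos by auto
    then have xy: "x = []" "y = []" using len by auto
    obtain c d where "s = [c]" "t = [d]" using l by (auto simp: length_Suc_conv)
    then show False using eq xy proper left_word_inject[of k a b c d] ab by auto
  next
    assume "left_word k [a] [b] = x @ right_word k s t @ y"
    from arg_cong[OF this, of length]
    have "2 * k + 2 = length x + length y + (2 * k + 1) * length t + 2 * length s"
      by (simp add: left_word_def right_word_def)
    moreover have "2 * k + 1 \<le> (2 * k + 1) * length t"
      using mult_le_mono2[OF pos(2), of "2 * k + 1"] by simp
    ultimately show False using pos by linarith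
  qed
qed

text \<open>The word \<open>b^(2k+1) a^2\<close> avoids the pattern \<open>s^(k+1) t^(k+1)\<close>: it contains \<open>a\<close> fewer than
  \<open>k + 1\<close> times, so \<open>s\<close> and \<open>t\<close> would be powers of \<open>b\<close>, but it contains \<open>b\<close> fewer than
  \<open>2 (k + 1)\<close> times.\<close>

lemma not_proper_right:
  assumes ab: "a \<noteq> b" and k: "2 \<le> k"
  shows "\<not> proper_instance k (right_word k [a] [b])"
proof
  assume "proper_instance k (right_word k [a] [b])"
  then obtain x y s t where st: "s \<noteq> []" "t \<noteq> []"
    and eq: "right_word k [a] [b] = x @ left_word k s t @ y \<or> right_word k [a] [b] = x @ right_word k s t @ y"
    and proper: "\<not> (x = [] \<and> y = [] \<and> length s = 1 \<and> length t = 1 \<and> s \<noteq> t)"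
    unfolding proper_instance_def by blast
  have pos: "1 \<le> length s" "1 \<le> length t" using st by (cases s; cases t; simp)+
  from eq show False
  proof
    assume eq: "right_word k [a] [b] = x @ left_word k s t @ y"
    have fil: "length (filter P (right_word k [a] [b])) \<ge>
        (k + 1) * (length (filter P s) + length (filter P t))" for P
      unfolding eq by (simp add: left_word_def length_filter_list_power algebra_simps)
    have "filter (\<lambda>z. z = a) (right_word k [a] [b]) = [a, a]" using ab by (simp add: right_word_def)
    with fil[of "\<lambda>z. z = a"]
    have "(k + 1) * (length (filter (\<lambda>z. z = a) s) + length (filter (\<lambda>z. z = a) t)) \<le> 2" by simp
    then have "length (filter (\<lambda>z. z = a) s) + length (filter (\<lambda>z. z = a) t) = 0"
      using k by (cases "length (filter (\<lambda>z. z = a) s) + length (filter (\<lambda>z. z = a) t)") auto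
    then have "a \<notin> set s" "a \<notin> set t" by (auto simp: filter_empty_conv)
    moreover have "set s \<union> set t \<subseteq> set (right_word k [a] [b])"
      unfolding eq by (auto simp: left_word_def set_list_power)
    then have "set s \<union> set t \<subseteq> {a, b}" by (auto simp: right_word_def)
    ultimately have "filter (\<lambda>z. z = b) s = s" "filter (\<lambda>z. z = b) t = t"
      by (auto simp: filter_id_conv)
    moreover have "length (filter (\<lambda>z. z = b) (right_word k [a] [b])) = 2 * k + 1"
      using ab by (simp add: right_word_def)
    ultimately have "(k + 1) * (length s + length t) \<le> 2 * k + 1"
      using fil[of "\<lambda>z. z = b"] by simp
    moreover have "(k + 1) * 2 \<le> (k + 1) * (length s + length t)"
      by (rule mult_le_mono2) (use pos in simp)
    ultimately show False by simp
  next
    assume eq: "right_word k [a] [b] = x @ right_word k s t @ y"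
    from arg_cong[OF this, of length]
    have len: "2 * k + 3 = length x + length y + (2 * k + 1) * length t + 2 * length s"
      by (simp add: right_word_def)
    have "\<not> 2 \<le> length t"
    proof
      assume "2 \<le> length t"
      then have "(2 * k + 1) * 2 \<le> (2 * k + 1) * length t" by (rule mult_le_mono2)
      then have "(2 * k + 1) * 2 + 2 * length s \<le> 2 * k + 3" unfolding len by simp
      then show False using pos(1) by simp
    qed
    then have t: "length t = 1" using pos by simp
    then have sum: "length x + length y + 2 * length s = 2" using len by simp
    then have l: "length s = 1" using pos(1) by linarith
    then have xy: "x = []" "y = []" using sum by simp_all
    obtain c d where "s = [c]" "t = [d]" using l t by (auto simp: length_Suc_conv)
    then show False using eq xy proper right_word_inject[of k a b c d] ab by auto
  qed
qed

lemma proper_instanceI: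
  assumes "s \<noteq> []" "t \<noteq> []" "w = x @ left_word k s t @ y \<or> w = x @ right_word k s t @ y"
    "\<not> (x = [] \<and> y = [] \<and> length s = 1 \<and> length t = 1 \<and> s \<noteq> t)"
  shows "proper_instance k w"
  unfolding proper_instance_def using assms by blast

lemma proper_instanceE:
  assumes "proper_instance k w"
  obtains x y s t where "s \<noteq> []" "t \<noteq> []"
    "w = x @ left_word k s t @ y \<or> w = x @ right_word k s t @ y"
    "\<not> (x = [] \<and> y = [] \<and> length s = 1 \<and> length t = 1 \<and> s \<noteq> t)"
  using assms unfolding proper_instance_def by blast

lemma proper_instance_append:
  assumes "proper_instance k w"
  shows "proper_instance k (w @ v)" "proper_instance k (v @ w)"
proof -
  from assms obtain x y s t where *: "s \<noteq> []" "t \<noteq> []"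
    "w = x @ left_word k s t @ y \<or> w = x @ right_word k s t @ y"
    "\<not> (x = [] \<and> y = [] \<and> length s = 1 \<and> length t = 1 \<and> s \<noteq> t)"
    by (rule proper_instanceE)
  show "proper_instance k (w @ v)"
    by (rule proper_instanceI[of s t _ x k "y @ v"]) (use * in auto)
  show "proper_instance k (v @ w)"
    by (rule proper_instanceI[of s t _ "v @ x" k y]) (use * in auto)
qed

lemma proper_instance_extend:
  assumes "v \<noteq> []"
  shows "proper_instance k (left_word k [a] [b] @ v)" "proper_instance k (v @ left_word k [a] [b])"
    "proper_instance k (right_word k [a] [b] @ v)" "proper_instance k (v @ right_word k [a] [b])"
  by (rule proper_instanceI[of "[a]" "[b]" _ "[]" k v], use assms in simp_all)
    (rule proper_instanceI[of "[a]" "[b]" _ v k "[]"], use assms in simp_all,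
     rule proper_instanceI[of "[a]" "[b]" _ "[]" k v], use assms in simp_all,
     rule proper_instanceI[of "[a]" "[b]" _ v k "[]"], use assms in simp_all)

lemma concat_map_left_right_word:
  "concat (map f (left_word k s t)) = left_word k (concat (map f s)) (concat (map f t))"
  "concat (map f (right_word k s t)) = right_word k (concat (map f s)) (concat (map f t))"
  by (simp_all add: left_word_def right_word_def concat_map_list_power)

lemma set_left_right_word:
  "set (left_word k s t) = set s \<union> set t" "set (right_word k s t) = set s \<union> set t"
  by (auto simp: left_word_def right_word_def set_list_power)

lemma proper_instance_concat_map:
  assumes "proper_instance k w" and f: "\<And>i. i \<in> set w \<Longrightarrow> f i \<noteq> []"
  shows "proper_instance k (concat (map f w))"
proof -
  from assms(1) obtain x y s t where st: "s \<noteq> []" "t \<noteq> []"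
    and w: "w = x @ left_word k s t @ y \<or> w = x @ right_word k s t @ y"
    and proper: "\<not> (x = [] \<and> y = [] \<and> length s = 1 \<and> length t = 1 \<and> s \<noteq> t)"
    by (rule proper_instanceE)
  let ?F = "\<lambda>v. concat (map f v)"
  have "set x \<union> set s \<union> set t \<union> set y \<subseteq> set w" using w by (auto simp: set_left_right_word)
  then have len: "length v \<le> length (?F v)" if "v \<in> {x, s, t, y}" for v
    using that by (intro length_concat_ge f) auto
  have "0 < length (?F s)" "0 < length (?F t)"
    using len[of s] len[of t] st by (metis insertCI length_greater_0_conv less_le_trans)+
  then have ne: "?F s \<noteq> []" "?F t \<noteq> []" by (metis length_greater_0_conv)+
  show ?thesis
  proof (rule proper_instanceI[OF ne, of _ "?F x" k "?F y"])
    show "?F w = ?F x @ left_word k (?F s) (?F t) @ ?F y \<or>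
        ?F w = ?F x @ right_word k (?F s) (?F t) @ ?F y"
      using w by (auto simp: concat_map_left_right_word)
    show "\<not> (?F x = [] \<and> ?F y = [] \<and> length (?F s) = 1 \<and> length (?F t) = 1 \<and> ?F s \<noteq> ?F t)"
    proof
      assume *: "?F x = [] \<and> ?F y = [] \<and> length (?F s) = 1 \<and> length (?F t) = 1 \<and> ?F s \<noteq> ?F t"
      then have "length x \<le> 0" "length y \<le> 0" "length s \<le> 1" "length t \<le> 1"
        using len[of x] len[of y] len[of s] len[of t]
        by (simp_all only: insert_iff simp_thms list.size)
      moreover have "s \<noteq> t" using * by auto
      ultimately show False using proper st by (cases s; cases t) auto
    qed
  qed
qed

definition pair_zeros :: "nat \<Rightarrow> uword set" where
  "pair_zeros k = {p. \<forall>w. flat p = Some w \<longrightarrow> 2 * k + 3 < length w \<or> proper_instance k w}"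

definition word_pairs :: "nat \<Rightarrow> identity set" where
  "word_pairs k = {(p, q). \<exists>a b. a \<noteq> b \<and>
     {flat p, flat q} = {Some (left_word k [a] [b]), Some (right_word k [a] [b])}}"

text \<open>The variety of nil semigroups given by \<open>x^(k+1) y^(k+1) = y^(2k+1) x^2\<close> and the vanishing of
  all longer products. The two sides avoid proper instances of each other and of themselves, so
  they remain nonzero and their class consists of just these two words.\<close>

definition pair_theory :: "nat \<Rightarrow> identity set" where
  "pair_theory k = nil_theory (pair_zeros k) (word_pairs k)"

lemma word_pairs_iff:
  "(p, q) \<in> word_pairs k \<longleftrightarrow> (\<exists>a b. a \<noteq> b \<and>
     (flat p = Some (left_word k [a] [b]) \<and> flat q = Some (right_word k [a] [b]) \<or>
      flat q = Some (left_word k [a] [b]) \<and> flat p = Some (right_word k [a] [b])))"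
  unfolding word_pairs_def by (auto simp: doubleton_eq_iff)

lemma word_pairs_sym: "(p, q) \<in> word_pairs k \<Longrightarrow> (q, p) \<in> word_pairs k"
  by (simp add: word_pairs_def insert_commute)

lemma word_pairs_flat: "flat p = flat q \<Longrightarrow> (p, r) \<in> word_pairs k \<Longrightarrow> (q, r) \<in> word_pairs k"
  by (simp add: word_pairs_def)

lemma word_pairs_unique:
  assumes "(p, q) \<in> word_pairs k" "(q, r) \<in> word_pairs k"
  shows "flat p = flat r"
proof -
  have "left_word k [a] [b] \<noteq> right_word k [c] [d]" for a b c d
    using left_right_word_length[of k a b] left_right_word_length[of k c d] by auto
  then show ?thesis
    using assms left_word_inject right_word_inject unfolding word_pairs_iff
    by (metis option.inject)
qed

lemma long_words_pair_zeros: "long_words (2 * k + 3) \<subseteq> pair_zeros k"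
  by (auto simp: long_words_iff pair_zeros_def)

lemma epigroup_theory_pair_theory:
  assumes k: "2 \<le> k"
  shows "epigroup_theory (pair_theory k)"
  unfolding pair_theory_def
proof (rule epigroup_theory_nil_theory)
  show "q \<in> pair_zeros k" if "flat p = flat q" "p \<in> pair_zeros k" for p q
    using that by (simp add: pair_zeros_def)
  show "p \<in> pair_zeros k" if "flat p = None" for p
    using that by (simp add: pair_zeros_def)
  show "Prod r p \<in> pair_zeros k" if "p \<in> pair_zeros k" for p r
    using that by (auto simp: pair_zeros_def proper_instance_append split: option.splits)
  show "Prod p r \<in> pair_zeros k" if "p \<in> pair_zeros k" for p r
    using that by (auto simp: pair_zeros_def proper_instance_append split: option.splits)
  show "\<exists>n. \<forall>u. power_word u n \<in> pair_zeros k"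
    using long_words_power long_words_pair_zeros by blast
  have inst: "\<exists>w f. flat p = Some w \<and> w' = concat (map f w) \<and> (\<forall>i\<in>set w. f i \<noteq> [])
      \<and> f = (\<lambda>i. the (flat (\<sigma> i)))" if "flat (substitute \<sigma> p) = Some w'" for p \<sigma> w'
  proof -
    obtain w where w: "flat p = Some w" "substitute_list \<sigma> w = Some w'"
      using \<open>flat (substitute \<sigma> p) = Some w'\<close> by (auto simp: flat_substitute bind_eq_Some_conv)
    then have "w' = concat (map (\<lambda>i. the (flat (\<sigma> i))) w)" "\<forall>i\<in>set w. flat (\<sigma> i) \<noteq> None"
      by (simp_all add: substitute_list_def split: if_splits)
    moreover have "\<forall>i\<in>set w. the (flat (\<sigma> i)) \<noteq> []"
      using calculation(2) flat_nonempty by fastforce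
    ultimately show ?thesis using w(1) by blast
  qed
  show "substitute \<sigma> p \<in> pair_zeros k" if p: "p \<in> pair_zeros k" for p \<sigma>
    unfolding pair_zeros_def
  proof clarify
    fix w' assume w': "flat (substitute \<sigma> p) = Some w'" "\<not> proper_instance k w'"
    then obtain w f where w: "flat p = Some w" "w' = concat (map f w)" "\<And>i. i \<in> set w \<Longrightarrow> f i \<noteq> []"
      using inst by blast
    then have "\<not> proper_instance k w" using w'(2) proper_instance_concat_map by blast
    then have "2 * k + 3 < length w" using p w(1) by (auto simp: pair_zeros_def)
    then show "2 * k + 3 < length w'" using length_concat_ge[of w f] w(2,3) by simp
  qed
  show "p \<notin> pair_zeros k" if "(p, q) \<in> word_pairs k" for p q
    using that not_proper_left[OF _ k] not_proper_right[OF _ k]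
    by (auto simp: word_pairs_iff pair_zeros_def left_right_word_length)
  show "Prod p r \<in> pair_zeros k \<and> Prod r p \<in> pair_zeros k" if "(p, q) \<in> word_pairs k" for p q r
    using that proper_instance_extend flat_nonempty[of r]
    by (cases "flat r") (auto simp: word_pairs_iff pair_zeros_def)
  show "(substitute \<sigma> p, substitute \<sigma> q) \<in> word_pairs k \<or>
      substitute \<sigma> p \<in> pair_zeros k \<and> substitute \<sigma> q \<in> pair_zeros k"
    if pq: "(p, q) \<in> word_pairs k" for p q \<sigma>
  proof -
    obtain a b where ab: "flat p = Some (left_word k [a] [b]) \<and> flat q = Some (right_word k [a] [b]) \<or>
        flat q = Some (left_word k [a] [b]) \<and> flat p = Some (right_word k [a] [b])"
      using pq[unfolded word_pairs_iff] by blast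
    show ?thesis
    proof (cases "flat (\<sigma> a) = None \<or> flat (\<sigma> b) = None")
      case True
      then have "flat (substitute \<sigma> p) = None" "flat (substitute \<sigma> q) = None"
        using ab by (auto simp: flat_substitute substitute_list_def set_left_right_word)
      then show ?thesis by (simp add: pair_zeros_def)
    next
      case False
      then obtain s t where st: "flat (\<sigma> a) = Some s" "flat (\<sigma> b) = Some t" by auto
      then have sub: "flat (substitute \<sigma> p) = Some (left_word k s t) \<and>
          flat (substitute \<sigma> q) = Some (right_word k s t) \<or>
          flat (substitute \<sigma> q) = Some (left_word k s t) \<and>
          flat (substitute \<sigma> p) = Some (right_word k s t)"
        using ab by (auto simp: flat_substitute substitute_list_def set_left_right_word
            concat_map_left_right_word)
      have ne: "s \<noteq> []" "t \<noteq> []" using st flat_nonempty by auto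
      show ?thesis
      proof (cases "length s = 1 \<and> length t = 1 \<and> s \<noteq> t")
        case True
        then obtain c d where "s = [c]" "t = [d]" "c \<noteq> d" by (auto simp: length_Suc_conv)
        then show ?thesis using sub by (auto simp: word_pairs_iff)
      next
        case False
        then have "proper_instance k (left_word k s t)" "proper_instance k (right_word k s t)"
          using proper_instanceI[OF ne, of _ "[]" k "[]"] by auto
        then show ?thesis using sub by (auto simp: pair_zeros_def)
      qed
    qed
  qed
qed (blast intro: word_pairs_sym word_pairs_flat word_pairs_unique)+

text \<open>Let \<open>p\<close> and \<open>q\<close> be the two sides of the identity, \<open>\<eta>\<close> the theory in which they form a
  class, and \<open>\<zeta>\<close> the theory of nilpotent semigroups in which all longer words are zero. For large
  \<open>k\<close>, both \<open>p\<close> and \<open>q\<close> are \<open>\<theta>\<close>-related to words that contain \<open>Bar\<close>, and these are zeros of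
  \<open>\<zeta>\<close>. By modularity \<open>p\<close> and \<open>q\<close> are joined by a chain of pairs in \<open>\<theta> \<inter> \<eta>\<close> or in \<open>\<zeta>\<close>. Such
  a chain cannot leave the class \<open>{p, q}\<close>, so it passes from \<open>p\<close> to \<open>q\<close> by a pair in \<open>\<theta>\<close>.\<close>

lemma modular_imp_identity:
  assumes \<theta>: "epigroup_theory \<theta>" and md: "modular_theory \<theta>"
  shows "\<exists>k. (Prod (power_word (Letter 0) k) (power_word (Letter 1) k),
    Prod (power_word (Letter 1) (2 * k)) (Prod (Letter 0) (Letter 0))) \<in> \<theta>"
proof -
  note fi = epigroup_theory_fi[OF \<theta>]
  obtain n where n: "\<And>m u. n \<le> m \<Longrightarrow> (Prod (power_word u m) (Prod u (Bar u)), power_word u m) \<in> \<theta>"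
    using epigroup_theory_power_absorb[OF \<theta>] by blast
  \<comment> \<open>At least \<open>n\<close>, so that \<open>Bar\<close> can be inserted next to the powers in both words, and at
    least \<open>2\<close>, so that the longer word avoids the shorter one.\<close>
  define k where "k = n + 2"
  have k: "2 \<le> k" "n \<le> k" "n \<le> 2 * k" by (auto simp: k_def)
  let ?x = "Letter 0" and ?y = "Letter 1"
  let ?p = "Prod (power_word ?x k) (power_word ?y k)"
  let ?q = "Prod (power_word ?y (2 * k)) (Prod ?x ?x)"
  let ?p' = "Prod (Prod (power_word ?x k) (Prod ?x (Bar ?x))) (power_word ?y k)"
  let ?q' = "Prod (Prod (power_word ?y (2 * k)) (Prod ?y (Bar ?y))) (Prod ?x ?x)"
  define \<eta> \<zeta> where "\<eta> = pair_theory k" and "\<zeta> = nilpotent (2 * k + 3)"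
  have flat: "flat ?p = Some (left_word k [0] [1])" "flat ?q = Some (right_word k [0] [1])"
    "flat ?p' = None" "flat ?q' = None"
    by (simp_all add: flat_power_Letter left_word_def right_word_def split: option.split)
  have pq: "(?p, ?q) \<in> word_pairs k" "(?q, ?p) \<in> word_pairs k"
    using flat(1,2) unfolding word_pairs_iff by (metis zero_neq_one)+
  have D_nonzero: "r \<notin> pair_zeros k" if "flat r = flat ?p \<or> flat r = flat ?q" for r
    using that not_proper_left[of 0 1 k] not_proper_right[of 0 1 k] k
    unfolding flat by (auto simp: pair_zeros_def left_right_word_length)
  have \<eta>: "epigroup_theory \<eta>" and \<zeta>: "epigroup_theory \<zeta>" and \<zeta>\<eta>: "\<zeta> \<subseteq> \<eta>"
    using epigroup_theory_pair_theory[OF k(1)] epigroup_theory_nilpotent long_words_pair_zeros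
    by (auto simp: \<eta>_def \<zeta>_def pair_theory_def nilpotent_def nil_theory_def)
  have "(?p, ?q) \<in> \<eta>" using pq by (simp add: \<eta>_def pair_theory_def nil_theory_def)
  moreover have "(?p, ?q) \<in> (\<theta> \<union> \<zeta>)\<^sup>*"
  proof -
    have "(?p, ?p') \<in> \<theta>" "(?q', ?q) \<in> \<theta>"
      using fi_Prod[OF fi n fi_refl[OF fi]] fi_sym[OF fi] k by blast+
    moreover have "(?p', ?q') \<in> \<zeta>" using flat by (simp add: \<zeta>_def nilpotent_def nil_theory_def)
    ultimately show ?thesis by (meson Un_iff r_into_rtrancl rtrancl.rtrancl_into_rtrancl)
  qed
  ultimately have "(?p, ?q) \<in> (\<theta> \<inter> \<eta> \<union> \<zeta>)\<^sup>*"
    using md[unfolded modular_theory_def, rule_format, OF \<eta> \<zeta> \<zeta>\<eta>] by blast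
  moreover have "(?p, r) \<in> \<theta> \<and> (flat r = flat ?p \<or> flat r = flat ?q)"
    if "(?p, r) \<in> (\<theta> \<inter> \<eta> \<union> \<zeta>)\<^sup>*" for r
    using that
  proof induction
    case base
    show ?case using fi_refl[OF fi] by blast
  next
    case (step r r')
    have r: "r \<notin> pair_zeros k" by (rule D_nonzero[OF conjunct2[OF step.IH]])
    from step(2) show ?case
    proof
      assume rr: "(r, r') \<in> \<theta> \<inter> \<eta>"
      then have "flat r = flat r' \<or> (r, r') \<in> word_pairs k"
        using r by (simp add: \<eta>_def pair_theory_def nil_theory_def)
      moreover have "flat r' = flat ?p \<or> flat r' = flat ?q" if "(r, r') \<in> word_pairs k"
        using step.IH word_pairs_unique[OF word_pairs_sym[OF that]]
          word_pairs_flat[OF _ pq(1)] word_pairs_flat[OF _ pq(2)] by metis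
      ultimately show ?thesis using step.IH rr fi_trans[OF fi] by (metis IntD1)
    next
      assume "(r, r') \<in> \<zeta>"
      then have eq: "flat r = flat r'"
        using r long_words_pair_zeros by (auto simp: \<zeta>_def nilpotent_def nil_theory_def)
      moreover have "flat r \<noteq> None" using step.IH flat by auto
      ultimately have "(r, r') \<in> \<theta>" by (rule in_theory_if_flat_eq[OF \<theta>])
      then show ?thesis using step.IH eq fi_trans[OF fi] by metis
    qed
  qed
  ultimately show ?thesis by blast
qed

section \<open>Modular monolithic varieties are nil\<close>

context epigroup_laws
begin

text \<open>An identity whose sides do not contain the same letters fails in every two-element
  semilattice. Two distinct commuting idempotents \<open>e\<close>, \<open>f\<close> would yield such a subsemigroup,
  \<open>{e, ef}\<close> or \<open>{f, ef}\<close>.\<close>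

lemma commuting_idempotents_eq:
  assumes pq: "(p, q) \<in> theory_of S" and y: "y \<in> letters q" "y \<notin> letters p"
    and e: "e \<in> carrier S" "e \<cdot> e = e" and f: "f \<in> carrier S" "f \<cdot> f = f" and ef: "e \<cdot> f = f \<cdot> e"
  shows "e = f"
proof -
  have below: "e = g" if e: "e \<in> carrier S" "e \<cdot> e = e" and g: "g \<in> carrier S" "g \<cdot> g = g"
    and eg: "e \<cdot> g = g" "g \<cdot> e = g" for e g
  proof -
    let ?h = "\<lambda>i. if i = y then g else e"
    have val: "word_val S ?h w = (if y \<in> letters w then g else e)" for w
      by (induction w) (auto simp: that idempotent_bar)
    have "range ?h \<subseteq> carrier S" using e g by auto
    from theory_ofD[OF pq this] show ?thesis using y by (simp add: val)
  qed
  have g: "e \<cdot> f \<in> carrier S" "e \<cdot> f \<cdot> (e \<cdot> f) = e \<cdot> f"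
    "e \<cdot> (e \<cdot> f) = e \<cdot> f" "e \<cdot> f \<cdot> e = e \<cdot> f" "f \<cdot> (e \<cdot> f) = e \<cdot> f" "e \<cdot> f \<cdot> f = e \<cdot> f"
    using e f ef closed by simp_all (metis assoc)+
  then have "e = e \<cdot> f" "f = e \<cdot> f" using below[OF e g(1,2)] below[OF f g(1,2)] by auto
  then show ?thesis by simp
qed

lemma semilattice_word_val:
  assumes idem: "\<And>x. x \<in> carrier S \<Longrightarrow> x \<cdot> x = x"
    and comm: "\<And>x y. x \<in> carrier S \<Longrightarrow> y \<in> carrier S \<Longrightarrow> x \<cdot> y = y \<cdot> x"
    and h: "range h \<subseteq> carrier S" and pq: "letters p = letters q"
  shows "word_val S h p = word_val S h q"
proof -
  have val: "word_val S h u \<in> carrier S" for u by (rule word_val_in_carrier[OF is_unary_alg h])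
  have hi: "h i \<in> carrier S" for i using h by auto
  have letter: "word_val S h u \<cdot> h i = word_val S h u" if "i \<in> letters u" for i u
    using that
  proof (induction u)
    case (Prod u v)
    show ?case
    proof (cases "i \<in> letters v")
      case True
      then show ?thesis using Prod val hi by (simp add: assoc)
    next
      case False
      then have "word_val S h u \<cdot> h i = word_val S h u" using Prod by simp
      then show ?thesis using val[of u] val[of v] hi[of i] comm[of "word_val S h v" "h i"]
        by (simp add: assoc) (metis assoc)
    qed
  qed (use idem hi val idempotent_bar in auto)
  have absorb: "word_val S h u \<cdot> word_val S h v = word_val S h u" if "letters v \<subseteq> letters u" for u v
    using that
  proof (induction v)
    case (Prod v w)
    then show ?case using val by (simp add: assoc[symmetric])
  qed (use letter idem val idempotent_bar in auto)
  show ?thesis using absorb[of p q] absorb[of q p] comm val pq by (metis order_refl)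
qed

end

lemma letters_differ:
  assumes "fully_invariant \<theta>" "\<not> \<theta> \<subseteq> semilattice_theory"
  obtains p q y where "(p, q) \<in> \<theta>" "y \<in> letters q" "y \<notin> letters p"
proof -
  obtain p q where "(p, q) \<in> \<theta>" "letters p \<noteq> letters q"
    using assms(2) by (auto simp: semilattice_theory_def)
  moreover from this(1) have "(q, p) \<in> \<theta>" by (rule fi_sym[OF assms(1)])
  ultimately show ?thesis using that by blast
qed

lemma proper_semilattice_subvariety_trivial:
  assumes \<alpha>: "epigroup_theory \<alpha>" and sl: "semilattice_theory \<subseteq> \<alpha>" "\<not> \<alpha> \<subseteq> semilattice_theory"
  shows "\<alpha> = UNIV"
proof -
  note fi = epigroup_theory_fi[OF \<alpha>]
  obtain p q y where pq: "(p, q) \<in> \<alpha>" "y \<in> letters q" "y \<notin> letters p"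
    using sl(2) by (rule letters_differ[OF fi])
  have "(Letter 0, Letter 1) \<in> \<alpha>"
  proof (rule in_theoryI[OF fi])
    fix S :: "uword unary_alg" and h :: "nat \<Rightarrow> uword"
    assume S: "S \<in> models \<alpha>" and h: "range h \<subseteq> carrier S"
    interpret epigroup_laws S by (rule epigroup_laws_models[OF \<alpha> S])
    have "(Prod (Letter i) (Letter i), Letter i) \<in> \<alpha>"
      "(Prod (Letter 0) (Letter 1), Prod (Letter 1) (Letter 0)) \<in> \<alpha>" for i
      using sl(1) by (auto simp: semilattice_theory_def)
    from this[THEN modelsD[OF S _ h]]
    have "prd S (h i) (h i) = h i" "prd S (h 0) (h 1) = prd S (h 1) (h 0)" for i by simp_all
    moreover have "h i \<in> carrier S" for i using h by auto
    moreover have "(p, q) \<in> theory_of S" using S pq(1) by (auto simp: models_iff)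
    ultimately show "word_val S h (Letter 0) = word_val S h (Letter 1)"
      using commuting_idempotents_eq pq(2,3) by simp
  qed
  then show ?thesis using theory_UNIV_I[OF fi] by auto
qed

lemma modular_models:
  assumes \<theta>: "epigroup_theory \<theta>" and md: "modular_theory \<theta>"
  shows "\<exists>k. \<forall>S\<in>models \<theta>. \<forall>x\<in>carrier S. \<forall>y\<in>carrier S.
    prd S (pow_Suc S x k) (pow_Suc S y k) = prd S (pow_Suc S y (2 * k)) (prd S x x)"
proof -
  obtain k where k: "(Prod (power_word (Letter 0) k) (power_word (Letter 1) k),
      Prod (power_word (Letter 1) (2 * k)) (Prod (Letter 0) (Letter 0))) \<in> \<theta>"
    using modular_imp_identity[OF \<theta> md] by blast
  have "prd S (pow_Suc S x k) (pow_Suc S y k) = prd S (pow_Suc S y (2 * k)) (prd S x x)"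
    if S: "S \<in> models \<theta>" and xy: "x \<in> carrier S" "y \<in> carrier S" for S x y
    using modelsD[OF S k, of "\<lambda>i. if i = 0 then x else y"] xy by auto
  then show ?thesis by (intro exI[of _ k] ballI)
qed

text \<open>Put \<open>y = x\<close>: the two sides of the identity have lengths \<open>2k + 2\<close> and \<open>2k + 3\<close>.\<close>

lemma (in epigroup_laws) aperiodic:
  assumes k: "\<And>x y. x \<in> carrier S \<Longrightarrow> y \<in> carrier S \<Longrightarrow>
      pow x k \<cdot> pow y k = pow y (2 * k) \<cdot> (x \<cdot> x)"
    and x: "x \<in> carrier S"
  shows "pow x (2 * k + 1) = pow x (2 * k + 2)"
proof -
  have "pow x (2 * k) \<cdot> (x \<cdot> x) = pow x (2 * k + 2)" using x by (simp add: assoc)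
  moreover have "pow x k \<cdot> pow x k = pow x (2 * k + 1)" using pow_add[OF x, of k k] by (simp add: mult_2)
  ultimately show ?thesis using k[OF x x] by simp
qed

lemma (in epigroup_laws) pow_left: "x \<in> carrier S \<Longrightarrow> x \<cdot> pow x n = pow x (Suc n)"
  using pow_add[of x 0 n] by simp

text \<open>Let \<open>A\<close> be the least nontrivial subvariety, with theory \<open>\<alpha>\<close>. Without the null semigroups,
  \<open>x\<close> is a multiple of \<open>x^(2k+2)\<close>, and aperiodicity gives \<open>x = x^2\<close>; then the identity becomes
  \<open>xy = yx\<close> and leaves only semilattices, which have no room for a proper subvariety \<open>A\<close>.
  So the null semigroups are present and \<open>A\<close> consists of them. Then semilattices are absent.
  As the identity makes idempotents commute, all idempotents are equal, and by
  aperiodicity the single idempotent is a zero, to which every pseudoinverse is equal.\<close>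

lemma modular_monolithic_imp_nil:
  assumes \<theta>: "epigroup_theory \<theta>" and md: "modular_theory \<theta>"
    and mono: "monolithic_nonatom_theory \<theta>"
  shows "nil \<theta>"
proof -
  note fi = epigroup_theory_fi[OF \<theta>]
  obtain \<alpha> where \<alpha>: "epigroup_theory \<alpha>" "\<theta> \<subset> \<alpha>" "\<alpha> \<noteq> UNIV"
    and least: "\<And>\<zeta>. epigroup_theory \<zeta> \<Longrightarrow> \<theta> \<subseteq> \<zeta> \<Longrightarrow> \<zeta> = UNIV \<or> \<zeta> \<subseteq> \<alpha>"
    using mono unfolding monolithic_nonatom_theory_def by blast
  note fi\<alpha> = epigroup_theory_fi[OF \<alpha>(1)]
  obtain k where "\<forall>S :: uword unary_alg \<in> models \<theta>. \<forall>x\<in>carrier S. \<forall>y\<in>carrier S.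
      prd S (pow_Suc S x k) (pow_Suc S y k) = prd S (pow_Suc S y (2 * k)) (prd S x x)"
    using modular_models[OF \<theta> md] by (rule exE)
  note k = this[rule_format]
  have null: "\<theta> \<subseteq> null_theory"
  proof (rule ccontr)
    assume not: "\<not> \<theta> \<subseteq> null_theory"
    have "semilattice_theory \<subseteq> \<theta>"
    proof clarify
      fix p q assume pq: "(p, q) \<in> semilattice_theory"
      show "(p, q) \<in> \<theta>"
      proof (rule in_theoryI[OF fi])
        fix S :: "uword unary_alg" and h :: "nat \<Rightarrow> uword"
        assume S: "S \<in> models \<theta>" and h: "range h \<subseteq> carrier S"
        interpret epigroup_laws S by (rule epigroup_laws_models[OF \<theta> S])
        have idem: "prd S x x = x" if x: "x \<in> carrier S" for x
        proof -
          have ap: "pow_Suc S x (2 * k + 1) = pow_Suc S x (2 * k + 2)"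
            by (rule aperiodic[OF k[OF S] x])
          obtain s where s: "s \<in> carrier S" "x = prd S (pow_Suc S x (2 * k + 1)) s"
            using not_below_null_theory[OF \<theta> not S x] \<alpha> by blast
          have "prd S x (prd S (pow_Suc S x (2 * k + 1)) s) = prd S (prd S x (pow_Suc S x (2 * k + 1))) s"
            by (rule assoc[symmetric, OF x pow_closed[OF x] s(1)])
          also have "\<dots> = prd S (pow_Suc S x (2 * k + 2)) s"
            using pow_left[OF x, of "2 * k + 1"] by simp
          finally have "prd S x (prd S (pow_Suc S x (2 * k + 1)) s) = prd S (pow_Suc S x (2 * k + 2)) s" .
          then show ?thesis using s(2) ap by metis
        qed
        have pow: "pow_Suc S x n = x" if "x \<in> carrier S" for x n
          by (induction n) (use that idem in auto)
        have comm: "prd S x y = prd S y x" if "x \<in> carrier S" "y \<in> carrier S" for x y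
          using k[OF S that] unfolding pow[OF that(1)] pow[OF that(2)] idem[OF that(1)] .
        have "letters p = letters q" using pq by (simp add: semilattice_theory_def)
        from semilattice_word_val[OF idem comm h this] show "word_val S h p = word_val S h q" .
      qed
    qed
    then show False using proper_semilattice_subvariety_trivial[OF \<alpha>(1)] \<alpha>(2,3) by blast
  qed
  have "\<not> \<theta> \<subseteq> semilattice_theory"
  proof
    assume "\<theta> \<subseteq> semilattice_theory"
    moreover have "(Letter 0, Letter 1) \<notin> semilattice_theory" by (simp add: semilattice_theory_def)
    ultimately have sl: "semilattice_theory \<subseteq> \<alpha>"
      using least[OF epigroup_theory_semilattice] by blast
    have nl: "null_theory \<subseteq> \<alpha>"
      using least[OF epigroup_theory_null null] null_theory_neq_UNIV by blast
    have "(Letter i, Prod (Letter i) (Letter i)) \<in> \<alpha>" for i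
      using sl by (auto simp: semilattice_theory_def)
    moreover have "(Prod (Letter 0) (Letter 0), Prod (Letter 1) (Letter 1)) \<in> \<alpha>"
      using nl by (auto simp: null_theory_def)
    ultimately have "(Letter 0, Letter 1) \<in> \<alpha>" using fi_trans[OF fi\<alpha>] fi_sym[OF fi\<alpha>] by blast
    then show False using theory_UNIV_I[OF fi\<alpha>] \<alpha>(3) by auto
  qed
  then obtain p q y where pq: "(p, q) \<in> \<theta>" "y \<in> letters q" "y \<notin> letters p"
    by (rule letters_differ[OF fi])
  have "word_val S h (Prod (Bar (Letter 0)) r) = word_val S h (Bar (Letter 0)) \<and>
      word_val S h (Prod r (Bar (Letter 0))) = word_val S h (Bar (Letter 0))"
    if S: "S \<in> models \<theta>" and h: "range h \<subseteq> carrier S" for S :: "uword unary_alg" and h r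
  proof -
    interpret epigroup_laws S by (rule epigroup_laws_models[OF \<theta> S])
    have pqS: "(p, q) \<in> theory_of S" using S pq(1) by (auto simp: models_iff)
    have unique: "e = f" if ef: "e \<in> carrier S" "prd S e e = e" "f \<in> carrier S" "prd S f f = f" for e f
    proof -
      have "pow_Suc S e n = e" "pow_Suc S f n = f" for n
        by (induction n) (use ef in auto)
      then have "prd S e f = prd S f e" using k[OF S ef(1,3)] ef by simp
      then show ?thesis using commuting_idempotents_eq[OF pqS pq(2,3)] ef by blast
    qed
    define z where "z x = pow_Suc S x (2 * k + 1)" for x
    have z: "z x \<in> carrier S" "prd S (z x) x = z x" "prd S x (z x) = z x" "prd S (z x) (z x) = z x"
      if x: "x \<in> carrier S" for x
    proof -
      have ap: "pow_Suc S x (2 * k + 1) = pow_Suc S x (2 * k + 2)"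
        by (rule aperiodic[OF k[OF S] x])
      show "z x \<in> carrier S" using x by (simp add: z_def del: pow_Suc.simps)
      show right: "prd S (z x) x = z x" using ap by (simp add: z_def)
      show "prd S x (z x) = z x" using ap pow_left[OF x, of "2 * k + 1"] by (simp add: z_def)
      have "prd S (z x) (pow_Suc S x n) = z x" for n
      proof (induction n)
        case (Suc n)
        then show ?case
          using right x assoc[of "z x" "pow_Suc S x n" x] \<open>z x \<in> carrier S\<close> by simp
      qed (use right in simp)
      then show "prd S (z x) (z x) = z x" by (simp only: z_def)
    qed
    have bar_z: "bar S x = z y" if xy: "x \<in> carrier S" "y \<in> carrier S" for x y
    proof -
      have b: "bar S x \<in> carrier S" by (rule bar_closed[OF xy(1)])
      have "prd S x (bar S x) = z (bar S x)"
        using unique z[OF b] idem_idempotent[OF xy(1)] closed[OF xy(1) b] by blast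
      then have "bar S x = z (bar S x)" using idem_bar[OF xy(1)] z[OF b] by simp
      moreover have "z (bar S x) = z y" using unique z[OF b] z[OF xy(2)] by blast
      ultimately show ?thesis by simp
    qed
    have "h 0 \<in> carrier S" using h by auto
    moreover have "word_val S h r \<in> carrier S" by (rule word_val_in_carrier[OF is_unary_alg h])
    ultimately show ?thesis using bar_z[of "h 0" "word_val S h r"] z[of "word_val S h r"] by simp
  qed
  then show ?thesis
    unfolding nil_def zeros_def by (auto intro!: in_theoryI[OF fi] simp del: word_val.simps)
qed

text \<open>Nilness passes from a variety to its subvarieties, so a larger variety can serve as witness.
  It must be allowed to be larger because the trivial variety and the variety of null semigroups
  are 0-reduced but have no nontrivial proper subvariety.\<close>

lemma zero_reduced_theory_iff:
  assumes \<theta>: "epigroup_theory \<theta>"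
  shows "zero_reduced_theory \<theta> \<longleftrightarrow> lower_modular_theory \<theta> \<and>
    (\<exists>\<omega>. epigroup_theory \<omega> \<and> \<omega> \<subseteq> \<theta> \<and> modular_theory \<omega> \<and> monolithic_nonatom_theory \<omega>)"
proof (intro iffI conjI)
  assume zr: "zero_reduced_theory \<theta>"
  then show "lower_modular_theory \<theta>" by (rule zero_reduced_imp_lower_modular)
  have zr2: "zero_reduced_theory (\<theta> \<inter> nilpotent 2)"
    using zr zero_reduced_nilpotent by (rule zero_reduced_theory_Inter)
  then show "\<exists>\<omega>. epigroup_theory \<omega> \<and> \<omega> \<subseteq> \<theta> \<and> modular_theory \<omega> \<and> monolithic_nonatom_theory \<omega>"
    using zero_reduced_imp_modular[OF zr2] monolithic_nilpotent_Inter[OF zr] zr_theory[OF zr2] by blast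
next
  assume *: "lower_modular_theory \<theta> \<and>
    (\<exists>\<omega>. epigroup_theory \<omega> \<and> \<omega> \<subseteq> \<theta> \<and> modular_theory \<omega> \<and> monolithic_nonatom_theory \<omega>)"
  then have "nil \<theta>"
    using modular_monolithic_imp_nil zeros_mono unfolding nil_def by blast
  then show "zero_reduced_theory \<theta>"
    using nil_lower_modular_imp_zero_reduced[OF \<theta>] * by blast
qed

section \<open>The defining formula\<close>

text \<open>In the formulas, \<open>0\<close> stands for the given variety, \<open>1\<close> for a modular monolithic variety above
  it and \<open>2\<close>, in the last formula, for the least nontrivial subvariety of that variety.\<close>

abbreviation LLe :: "lterm \<Rightarrow> lterm \<Rightarrow> lform" where
  "LLe s t \<equiv> LEq (LMeet s t) s"

definition lower_modular_form :: lform where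
  "lower_modular_form = LAll 2 (LAll 3 (LImp (LLe (LVar 0) (LVar 2))
     (LEq (LJoin (LVar 0) (LMeet (LVar 2) (LVar 3)))
          (LMeet (LVar 2) (LJoin (LVar 0) (LVar 3))))))"

definition modular_form :: lform where
  "modular_form = LAll 2 (LAll 3 (LImp (LLe (LVar 2) (LVar 3))
     (LEq (LMeet (LJoin (LVar 1) (LVar 2)) (LVar 3))
          (LJoin (LMeet (LVar 1) (LVar 3)) (LVar 2)))))"

abbreviation bottom_form :: "nat \<Rightarrow> lform" where
  "bottom_form i \<equiv> LAll 4 (LLe (LVar i) (LVar 4))"

definition monolithic_nonatom_form :: lform where
  "monolithic_nonatom_form = LEx 2 (LAnd
     (LAnd (LLe (LVar 2) (LVar 1)) (LNot (LEq (LVar 2) (LVar 1))))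
     (LAnd (LNot (bottom_form 2))
       (LAll 3 (LImp (LLe (LVar 3) (LVar 1)) (LOr (bottom_form 3) (LLe (LVar 2) (LVar 3)))))))"

definition zero_reduced_form :: lform where
  "zero_reduced_form = LAnd lower_modular_form
     (LEx 1 (LAnd (LLe (LVar 0) (LVar 1)) (LAnd modular_form monolithic_nonatom_form)))"

theorem proposition8p1:
  assumes "infinite (UNIV :: 'a set)"
  shows "definable_in (EPI :: 'a unary_alg set set) epi_join epi_meet
           {V. zero_reduced_variety V}"
proof -
  note inf = assms
  have EPI: "(EPI :: 'a unary_alg set set) = models ` {\<theta>. epigroup_theory \<theta>}"
    by (rule EPI_eq[OF inf])
  have le: "epi_meet X Y = X \<longleftrightarrow> X \<subseteq> Y" for X Y :: "'a unary_alg set"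
    by (auto simp: epi_meet_def)
  note meet = epi_meet_models and join = epi_join_models[OF inf]
  note E = epigroup_theory_Inter epigroup_theory_rtrancl
  note mono = models_mono_iff[OF inf epigroup_theory_fi] and eq = models_eq_iff[OF inf]
  have bottom: "(\<forall>b\<in>(EPI :: 'a unary_alg set set). models \<theta> \<subseteq> b) \<longleftrightarrow> \<theta> = UNIV"
    if \<theta>: "epigroup_theory \<theta>" for \<theta>
  proof
    assume *: "\<forall>b\<in>(EPI :: 'a unary_alg set set). models \<theta> \<subseteq> b"
    have "fully_invariant UNIV" by (rule fully_invariantI) auto
    then have "epigroup_theory UNIV" by (simp add: epigroup_theory_def)
    then have "(models \<theta> :: 'a unary_alg set) \<subseteq> models UNIV" using * EPI by blast
    then show "\<theta> = UNIV" using mono[OF \<theta>] by auto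
  next
    assume "\<theta> = UNIV"
    then show "\<forall>b\<in>(EPI :: 'a unary_alg set set). models \<theta> \<subseteq> b" using mono[OF \<theta>] by (auto simp: EPI)
  qed
  have "holds (EPI :: 'a unary_alg set set) epi_join epi_meet (\<lambda>_. models \<theta>) zero_reduced_form
      \<longleftrightarrow> zero_reduced_theory \<theta>" if \<theta>: "epigroup_theory \<theta>" for \<theta>
  proof -
    have lm: "holds (EPI :: 'a unary_alg set set) epi_join epi_meet (\<lambda>_. models \<theta>) lower_modular_form
        \<longleftrightarrow> lower_modular_theory \<theta>"
      using \<theta> by (simp add: lower_modular_form_def EPI le meet join E mono eq lower_modular_theory_def)
        (auto simp: Int_commute)
    have md: "holds EPI epi_join epi_meet ((\<lambda>_. models \<theta>)(1 := models \<omega> :: 'a unary_alg set)) modular_form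
        \<longleftrightarrow> modular_theory \<omega>" if \<omega>: "epigroup_theory \<omega>" for \<omega>
      using \<omega> by (simp add: modular_form_def EPI le meet join E mono eq modular_theory_def)
        (auto simp: Int_commute)
    have mn: "holds EPI epi_join epi_meet ((\<lambda>_. models \<theta>)(1 := models \<omega> :: 'a unary_alg set))
        monolithic_nonatom_form \<longleftrightarrow> monolithic_nonatom_theory \<omega>" if \<omega>: "epigroup_theory \<omega>" for \<omega>
    proof -
      define bot where "bot b \<longleftrightarrow> (\<forall>d\<in>(EPI :: 'a unary_alg set set). b \<subseteq> d)" for b
      have "holds EPI epi_join epi_meet ((\<lambda>_. models \<theta>)(1 := models \<omega> :: 'a unary_alg set))
          monolithic_nonatom_form \<longleftrightarrow>
        (\<exists>b\<in>(EPI :: 'a unary_alg set set). (b \<subseteq> models \<omega> \<and> b \<noteq> models \<omega>) \<and> \<not> bot b \<and>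
          (\<forall>c\<in>EPI. c \<subseteq> models \<omega> \<longrightarrow> bot c \<or> b \<subseteq> c))"
        by (simp add: monolithic_nonatom_form_def le bot_def)
      also have "\<dots> \<longleftrightarrow> monolithic_nonatom_theory \<omega>"
        using \<omega> bottom[folded bot_def]
        by (simp add: EPI mono eq monolithic_nonatom_theory_def psubset_eq) (metis eq)
      finally show ?thesis .
    qed
    show ?thesis
      unfolding zero_reduced_theory_iff[OF \<theta>] zero_reduced_form_def holds.simps lm
      using md mn by (auto simp: EPI le mono \<theta>)
  qed
  moreover have "free_vars zero_reduced_form = {0}"
    by (auto simp: zero_reduced_form_def lower_modular_form_def modular_form_def
        monolithic_nonatom_form_def)
  moreover have "{V. zero_reduced_variety V} \<subseteq> (EPI :: 'a unary_alg set set)"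
    by (auto simp: zero_reduced_variety_def EPI_def)
  moreover note zero_reduced_variety_models_iff[OF inf]
  ultimately show ?thesis
    unfolding definable_in_def EPI
    by (intro conjI exI[of _ zero_reduced_form] exI[of _ 0]) auto
qed

end
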